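(* Let $\phi$ (with potential $\Phi$), $F$ and $j$ satisfy the standing assumptions stated in the context. Then any critical point of the energy functional $\mathcal{E}=\Psi+J+\mathcal{F}:C\to(-\infty,+\infty]$ is a solution of the boundary value problem $$-[\phi(u')]'=\nabla_uF(t,u)\ \text{ in }[0,T],\qquad \big(\phi(u')(0),-\phi(u')(T)\big)\in\partial j(u(0),u(T)).$$
   Context: $N\ge 1$ is an integer, $T>0$, $0<a<\infty$; $\langle\cdot|\cdot\rangle$ and $|\cdot|$ are the Euclidean inner product and norm on $\mathbb{R}^N$; $B_a$ is the open ball of radius $a$ centered at $0$. Standing assumptions. (1) $\phi$ is a homeomorphism from $B_a$ onto $\mathbb{R}^N$ with $\phi(0)=0$ and $\phi=\nabla\Phi$ on $B_a$, where $\Phi:\overline{B}_a\to(-\infty,0]$ is of class $C^1$ on $B_a$, and continuous and strictly convex on $\overline{B}_a$. (2) $F=F(t,u):[0,T]\times\mathbb{R}^N\to\mathbb{R}$ is continuous, $\nabla_uF$ exists and is continuous on $[0,T]\times\mathbb{R}^N$, and $F(\cdot,0)=0$. (3) $j:\mathbb{R}^N\times\mathbb{R}^N\to(-\infty,+\infty]$ is proper, convex, lower semicontinuous, $j(0)=0$ and $0\in\partial j(0)$, where $\partial j$ is the subdifferential of convex analysis. A solution of the boundary value problem is a function $u\in C^1([0,T];\mathbb{R}^N)$ with $|u'(t)|<a$ for all $t\in[0,T]$, $\phi(u')\in C^1([0,T];\mathbb{R}^N)$, $(u(0),u(T))\in D(\partial j)=\{z:\partial j(z)\ne\emptyset\}$,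 satisfying the system and the boundary condition; $\phi(u')(t)=\phi(u'(t))$. $C:=C([0,T];\mathbb{R}^N)$ with the uniform norm; $W^{1,\infty}:=W^{1,\infty}([0,T];\mathbb{R}^N)$; $\mathcal{K}:=\{v\in W^{1,\infty}:\|v'\|_{L^\infty}\le a\}$. $\Psi:C\to(-\infty,+\infty]$ is $\Psi(v)=\int_0^T[\Phi(v')-\Phi(0)]\,dt$ if $v\in\mathcal{K}$ and $\Psi(v)=+\infty$ otherwise; $J(v)=j(v(0),v(T))$; $\mathcal{F}(v)=-\int_0^TF(t,v(t))\,dt$ for $v\in C$, which is of class $C^1$ with $\langle\mathcal{F}'(u),v\rangle=-\int_0^T\langle\nabla_uF(t,u)|v\rangle dt$. $D(\Psi+J)=\{v\in\mathcal{K}:j(v(0),v(T))<+\infty\}$. An element $u\in D(\Psi+J)$ is a critical point of $\mathcal{E}$ if $$(\Psi+J)(v)-(\Psi+J)(u)+\langle\mathcal{F}'(u),v-u\rangle\ge 0\quad\text{for all }v\in D(\Psi+J).$$ *)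

theory Defs
  imports "HOL-Analysis.Analysis" "HOL-Probability.Essential_Supremum"
begin

section \<open>Convex analysis and gradients\<close>

definition strictly_convex_on :: "'a::real_vector set \<Rightarrow> ('a \<Rightarrow> real) \<Rightarrow> bool" where
  "strictly_convex_on S f \<longleftrightarrow> convex S \<and>
     (\<forall>x\<in>S. \<forall>y\<in>S. \<forall>s. x \<noteq> y \<and> 0 < s \<and> s < 1 \<longrightarrow>
        f ((1 - s) *\<^sub>R x + s *\<^sub>R y) < (1 - s) * f x + s * f y)"

definition proper_fun :: "('a \<Rightarrow> ereal) \<Rightarrow> bool" where
  "proper_fun j \<longleftrightarrow> (\<forall>z. j z \<noteq> - \<infinity>) \<and> (\<exists>z. j z < \<infinity>)"

definition ereal_convex :: "('a::real_vector \<Rightarrow> ereal) \<Rightarrow> bool" where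
  "ereal_convex j \<longleftrightarrow>
     (\<forall>x y s. 0 < s \<and> s < 1 \<longrightarrow>
        j ((1 - s) *\<^sub>R x + s *\<^sub>R y) \<le> ereal (1 - s) * j x + ereal s * j y)"

definition lower_semicontinuous :: "('a::topological_space \<Rightarrow> ereal) \<Rightarrow> bool" where
  "lower_semicontinuous j \<longleftrightarrow> (\<forall>x. j x \<le> Liminf (at x) j)"

text \<open>For proper \<open>j\<close> the subdifferential is empty at every point where \<open>j\<close> is infinite.\<close>

definition subdifferential :: "('a::real_inner \<Rightarrow> ereal) \<Rightarrow> 'a \<Rightarrow> 'a set" where
  "subdifferential j z = {\<zeta>. \<forall>\<xi>. j z + ereal (\<zeta> \<bullet> (\<xi> - z)) \<le> j \<xi>}"

definition subdiff_dom :: "('a::real_inner \<Rightarrow> ereal) \<Rightarrow> 'a set" where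
  "subdiff_dom j = {z. subdifferential j z \<noteq> {}}"

definition gradient :: "('a::real_inner \<Rightarrow> real) \<Rightarrow> 'a \<Rightarrow> 'a" where
  "gradient f x = (THE D. GDERIV f x :> D)"


section \<open>Function spaces on \<open>[0, T]\<close>\<close>

text \<open>Elements of the spaces below are total functions on the reals; only their values on
  \<open>[0, T]\<close> matter.\<close>

definition C0 :: "real \<Rightarrow> (real \<Rightarrow> 'a::euclidean_space) set" where
  "C0 T = {v. continuous_on {0..T} v}"

definition norm_C :: "real \<Rightarrow> (real \<Rightarrow> 'a::euclidean_space) \<Rightarrow> real" where
  "norm_C T v = (SUP t\<in>{0..T}. norm (v t))"

text \<open>The derivative on the closed interval, one-sided at the end points.\<close>

definition ivl_deriv :: "real \<Rightarrow> (real \<Rightarrow> 'a::euclidean_space) \<Rightarrow> real \<Rightarrow> 'a" where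
  "ivl_deriv T v t = vector_derivative v (at t within {0..T})"

definition C1 :: "real \<Rightarrow> (real \<Rightarrow> 'a::euclidean_space) set" where
  "C1 T = {v. v differentiable_on {0..T} \<and> continuous_on {0..T} (ivl_deriv T v)}"

definition norm_Linf :: "real \<Rightarrow> (real \<Rightarrow> 'a::euclidean_space) \<Rightarrow> ereal" where
  "norm_Linf T g = esssup (lebesgue_on {0..T}) (\<lambda>t. ereal (norm (g t)))"

definition Linf :: "real \<Rightarrow> (real \<Rightarrow> 'a::euclidean_space) set" where
  "Linf T = {g \<in> borel_measurable (lebesgue_on {0..T}). norm_Linf T g < \<infinity>}"

definition test_fun :: "real \<Rightarrow> (real \<Rightarrow> real) set" where
  "test_fun T = {\<eta>. \<eta> C1_differentiable_on UNIV \<and> closure {t. \<eta> t \<noteq> 0} \<subseteq> {0<..<T}}"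

definition has_weak_deriv ::
    "real \<Rightarrow> (real \<Rightarrow> 'a::euclidean_space) \<Rightarrow> (real \<Rightarrow> 'a) \<Rightarrow> bool" where
  "has_weak_deriv T v g \<longleftrightarrow>
     (\<forall>\<eta>\<in>test_fun T. (LINT t|lebesgue_on {0..T}. deriv \<eta> t *\<^sub>R v t)
                      = - (LINT t|lebesgue_on {0..T}. \<eta> t *\<^sub>R g t))"

text \<open>As usual in dimension one, a Sobolev function is identified with its continuous
  representative, so that \<open>W1inf T\<close> is a subset of \<open>C0 T\<close>.\<close>

definition W1inf :: "real \<Rightarrow> (real \<Rightarrow> 'a::euclidean_space) set" where
  "W1inf T = {v \<in> C0 T. \<exists>g\<in>Linf T. has_weak_deriv T v g}"

text \<open>The weak derivative is determined only almost everywhere on \<open>[0, T]\<close>; everything below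
  depends only on its class.\<close>

definition weak_deriv :: "real \<Rightarrow> (real \<Rightarrow> 'a::euclidean_space) \<Rightarrow> real \<Rightarrow> 'a" where
  "weak_deriv T v = (SOME g. g \<in> Linf T \<and> has_weak_deriv T v g)"

text \<open>Frechet derivative of a functional on the Banach space \<open>C0 T\<close>. The derivative at \<open>u\<close> is
  unique as a functional on \<open>C0 T\<close>.\<close>

definition has_frechet_deriv_C ::
    "real \<Rightarrow> ((real \<Rightarrow> 'a::euclidean_space) \<Rightarrow> real) \<Rightarrow> (real \<Rightarrow> 'a) \<Rightarrow>
     ((real \<Rightarrow> 'a) \<Rightarrow> real) \<Rightarrow> bool" where
  "has_frechet_deriv_C T G u L \<longleftrightarrow>
     (\<forall>h\<in>C0 T. \<forall>k\<in>C0 T. L (\<lambda>t. h t + k t) = L h + L k) \<and>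
     (\<forall>c. \<forall>h\<in>C0 T. L (\<lambda>t. c *\<^sub>R h t) = c * L h) \<and>
     (\<exists>B. \<forall>h\<in>C0 T. \<bar>L h\<bar> \<le> B * norm_C T h) \<and>
     (\<forall>\<epsilon>>0. \<exists>\<delta>>0. \<forall>h\<in>C0 T. norm_C T h < \<delta> \<longrightarrow>
        \<bar>G (\<lambda>t. u t + h t) - G u - L h\<bar> \<le> \<epsilon> * norm_C T h)"

definition frechet_deriv_C ::
    "real \<Rightarrow> ((real \<Rightarrow> 'a::euclidean_space) \<Rightarrow> real) \<Rightarrow> (real \<Rightarrow> 'a) \<Rightarrow>
     (real \<Rightarrow> 'a) \<Rightarrow> real" where
  "frechet_deriv_C T G u = (SOME L. has_frechet_deriv_C T G u L)"


section \<open>The energy functional and its critical points\<close>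

definition K_set :: "real \<Rightarrow> real \<Rightarrow> (real \<Rightarrow> 'a::euclidean_space) set" where
  "K_set T a = {v \<in> W1inf T. norm_Linf T (weak_deriv T v) \<le> ereal a}"

text \<open>In \<open>Psi\<close> the potential is evaluated outside the closed ball of radius \<open>a\<close> only on a null
  set, and Lebesgue measure is complete, so the integrand is a bounded measurable function up to a
  null set.\<close>

definition Psi ::
    "real \<Rightarrow> real \<Rightarrow> ('a \<Rightarrow> real) \<Rightarrow> (real \<Rightarrow> 'a::euclidean_space) \<Rightarrow> ereal" where
  "Psi T a \<Phi> v =
     (if v \<in> K_set T a
      then ereal (LINT t|lebesgue_on {0..T}. \<Phi> (weak_deriv T v t) - \<Phi> 0)
      else \<infinity>)"

definition J_fun :: "real \<Rightarrow> ('a \<times> 'a \<Rightarrow> ereal) \<Rightarrow> (real \<Rightarrow> 'a::euclidean_space) \<Rightarrow> ereal" where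
  "J_fun T j v = j (v 0, v T)"

definition F_fun ::
    "real \<Rightarrow> (real \<Rightarrow> 'a \<Rightarrow> real) \<Rightarrow> (real \<Rightarrow> 'a::euclidean_space) \<Rightarrow> real" where
  "F_fun T F v = - (LINT t|lebesgue_on {0..T}. F t (v t))"

definition PsiJ_dom ::
    "real \<Rightarrow> real \<Rightarrow> ('a \<times> 'a \<Rightarrow> ereal) \<Rightarrow> (real \<Rightarrow> 'a::euclidean_space) set" where
  "PsiJ_dom T a j = {v \<in> K_set T a. j (v 0, v T) < \<infinity>}"

text \<open>Critical points (in the sense of Szulkin) of \<open>Psi + J + F\<close>, with \<open>Psi + J\<close> convex and
  \<open>F\<close> continuously differentiable on \<open>C0 T\<close>. All extended real values involved are finite
  when \<open>j\<close> is proper.\<close>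

definition critical_point ::
    "real \<Rightarrow> real \<Rightarrow> ('a \<Rightarrow> real) \<Rightarrow> ('a \<times> 'a \<Rightarrow> ereal) \<Rightarrow> (real \<Rightarrow> 'a \<Rightarrow> real) \<Rightarrow>
     (real \<Rightarrow> 'a::euclidean_space) \<Rightarrow> bool" where
  "critical_point T a \<Phi> j F u \<longleftrightarrow>
     u \<in> PsiJ_dom T a j \<and>
     (\<forall>v\<in>PsiJ_dom T a j.
        (Psi T a \<Phi> v + J_fun T j v) - (Psi T a \<Phi> u + J_fun T j u)
          + ereal (frechet_deriv_C T (F_fun T F) u (\<lambda>t. v t - u t)) \<ge> 0)"


section \<open>The boundary value problem\<close>

definition bvp_solution ::
    "real \<Rightarrow> real \<Rightarrow> ('a \<Rightarrow> 'a) \<Rightarrow> ('a \<times> 'a \<Rightarrow> ereal) \<Rightarrow> (real \<Rightarrow> 'a \<Rightarrow> real) \<Rightarrow>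
     (real \<Rightarrow> 'a::euclidean_space) \<Rightarrow> bool" where
  "bvp_solution T a \<phi> j F u \<longleftrightarrow>
     u \<in> C1 T \<and>
     (\<forall>t\<in>{0..T}. norm (ivl_deriv T u t) < a) \<and>
     (\<lambda>t. \<phi> (ivl_deriv T u t)) \<in> C1 T \<and>
     (u 0, u T) \<in> subdiff_dom j \<and>
     (\<forall>t\<in>{0..T}. - ivl_deriv T (\<lambda>s. \<phi> (ivl_deriv T u s)) t = gradient (F t) (u t)) \<and>
     (\<phi> (ivl_deriv T u 0), - \<phi> (ivl_deriv T u T)) \<in> subdifferential j (u 0, u T)"

end

theory Submission
  imports Defs
begin

text \<open>Write \<open>w = u'\<close>, \<open>h(t) = \<nabla>\<^sub>uF(t, u(t))\<close> and \<open>H(t) = \<integral>\<^sub>0\<^sup>t h\<close>. Comparing \<open>u\<close> with \<open>(1 - s) u\<close> and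
  using \<open>j \<ge> 0 = j(0)\<close>, the integrals of \<open>\<langle>\<phi>((1 - s) w)|w\<rangle>\<close> stay bounded as \<open>s \<rightarrow> 0\<close>; since \<open>|\<phi>|\<close> blows up
  at the sphere, \<open>|w| < a\<close> almost everywhere. On each set \<open>{|w| \<le> r}\<close> with \<open>r < a\<close> one may then vary \<open>w\<close> in
  both directions with fixed boundary values of \<open>u\<close>, which forces \<open>\<phi>(w) + H\<close> to be a constant \<open>c\<close>.
  Hence \<open>w = \<phi>\<^sup>-\<^sup>1(c - H)\<close> has a continuous representative and \<open>\<phi>(u') = c - H\<close> everywhere. Finally,
  moving \<open>u\<close> towards an affine function with boundary values \<open>(x, y)\<close> gives the subgradient
  inequality for \<open>j\<close> at \<open>(x, y)\<close>.\<close>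

section \<open>Primitives of bounded measurable functions\<close>

text \<open>A critical point is only known to satisfy \<open>norm (w t) \<le> a\<close>. On the
  sphere no gradient of \<open>\<Phi>\<close> is available, and a general variation may leave the
  closed ball there; shrinking towards 0 stays admissible, so it has to be used before anything
  else. Differentiation at \<open>w\<close> is avoided: convexity is applied at the moved point
  \<open>w + s z\<close>, which lies in the open ball, and the resulting estimate is one-sided,
  which is all that a variational inequality needs. The weak derivative and the Frechet derivative
  are defined by arbitrary choice. Both must be shown unique, the former almost everywhere, before
  the inequality can be written with a representative bounded everywhere and an explicit integral.
  Variations are only bounded measurable, so integration by parts has to work for primitives that
  are merely Lipschitz. The reduced inequality is used twice: with \<open>w\<close>, to find the
  constant c, and again with the continuous representative. The norm of the latter has a maximum
  below \<open>a\<close>, so variations of the derivative need no localisation when the boundary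
  values are moved.\<close>

text \<open>Completeness of Lebesgue measure. It serves integrands containing \<open>\<Phi>\<close>
  of a weak derivative, which may leave the closed ball on a null set.\<close>

lemma borel_measurable_lebesgue_on_AE_cong:
  fixes f g :: "'a::euclidean_space \<Rightarrow> 'b::euclidean_space"
  assumes f: "f \<in> borel_measurable (lebesgue_on S)" and S: "S \<in> sets lebesgue"
    and ae: "AE x in lebesgue_on S. f x = g x"
  shows "g \<in> borel_measurable (lebesgue_on S)"
proof -
  have "(\<lambda>x. indicator S x *\<^sub>R f x) \<in> borel_measurable lebesgue"
    using f S by (subst (asm) borel_measurable_restrict_space_iff) auto
  moreover have "AE x in lebesgue. x \<in> S \<longrightarrow> f x = g x"
    using ae S by (subst (asm) AE_restrict_space_iff) auto
  then have "AE x in lebesgue. indicator S x *\<^sub>R f x = indicator S x *\<^sub>R g x"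
    by (rule AE_mp) (auto simp: indicator_def)
  ultimately have "(\<lambda>x. indicator S x *\<^sub>R g x) \<in> borel_measurable lebesgue"
    by (rule borel_measurable_AE)
  then show ?thesis
    using S by (subst borel_measurable_restrict_space_iff) auto
qed

lemma integrable_bounded_ivl:
  fixes f :: "real \<Rightarrow> 'a::euclidean_space"
  assumes "f \<in> borel_measurable (lebesgue_on {a..b})" "\<And>t. t \<in> {a..b} \<Longrightarrow> norm (f t) \<le> B"
  shows "integrable (lebesgue_on {a..b}) f"
  by (rule measurable_bounded_by_integrable_imp_lebesgue_integrable[where g="\<lambda>_. B"])
     (use assms in auto)

lemma integrable_continuous_ivl:
  fixes f :: "real \<Rightarrow> 'a::euclidean_space"
  assumes "continuous_on {a..b} f"
  shows "integrable (lebesgue_on {a..b}) f"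
proof -
  have "bounded (f ` {a..b})"
    using assms compact_continuous_image compact_imp_bounded by blast
  then obtain B where "\<forall>t\<in>{a..b}. norm (f t) \<le> B"
    by (auto simp: bounded_iff)
  then show ?thesis
    using assms by (intro integrable_bounded_ivl[where B=B]) (auto intro: continuous_imp_measurable_on_sets_lebesgue)
qed

lemma continuous_on_primitive:
  fixes f :: "real \<Rightarrow> 'a::euclidean_space"
  assumes "integrable (lebesgue_on {a..b}) f"
  shows "continuous_on {a..b} (\<lambda>t. integral {a..t} f)"
  using assms by (intro indefinite_integral_continuous_1 integrable_on_lebesgue_on) auto

lemma norm_integral_bound_ivl:
  fixes f :: "real \<Rightarrow> 'a::euclidean_space"
  assumes "f integrable_on {s..t}" "s \<le> t" "\<And>r. r \<in> {s..t} \<Longrightarrow> norm (f r) \<le> B"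
  shows "norm (integral {s..t} f) \<le> B * (t - s)"
proof -
  have "0 \<le> B" using assms(3)[of s] \<open>s \<le> t\<close> norm_ge_zero[of "f s"] by (auto simp del: norm_ge_zero)
  then show ?thesis
    using has_integral_bound_real[of B "{}" f "integral {s..t} f" s t] assms by auto
qed

text \<open>A quadratic modulus makes the derivative vanish at every point, with no exceptional null
  set. This replaces absolute continuity in the integration by parts.\<close>

lemma constant_if_quadratic_modulus:
  fixes P :: "real \<Rightarrow> 'a::real_normed_vector"
  assumes P: "\<And>s t. a \<le> s \<Longrightarrow> s \<le> t \<Longrightarrow> t \<le> b \<Longrightarrow> norm (P t - P s) \<le> K * (t - s)\<^sup>2"
    and x: "x \<in> {a..b}" and y: "y \<in> {a..b}"
  shows "P x = P y"
proof (rule has_derivative_zero_unique[where s="{a..b}"])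
  fix x assume x: "x \<in> {a..b}"
  show "(P has_derivative (\<lambda>h. 0)) (at x within {a..b})"
    unfolding has_derivative_within_alt
  proof (intro conjI allI impI)
    show "bounded_linear (\<lambda>h::real. 0::'a)" by simp
    fix e :: real assume e: "0 < e"
    let ?d = "e / (\<bar>K\<bar> + 1)"
    have "norm (P y - P x - 0) \<le> e * norm (y - x)" if y: "y \<in> {a..b}" "norm (y - x) < ?d" for y
    proof -
      have "norm (P y - P x) \<le> K * (y - x)\<^sup>2"
        using P[of x y] P[of y x] x y by (cases "x \<le> y") (auto simp: norm_minus_commute power2_commute)
      also have "\<dots> \<le> \<bar>K\<bar> * (\<bar>y - x\<bar> * \<bar>y - x\<bar>)"
        by (simp add: power2_eq_square mult_right_mono)
      also have "\<dots> = (\<bar>K\<bar> * \<bar>y - x\<bar>) * \<bar>y - x\<bar>" by simp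
      also have "\<dots> \<le> e * \<bar>y - x\<bar>"
      proof (rule mult_right_mono)
        have "\<bar>K\<bar> * \<bar>y - x\<bar> \<le> (\<bar>K\<bar> + 1) * ?d"
          using y by (intro mult_mono) auto
        also have "\<dots> = e" by (simp add: field_simps add_eq_0_iff)
        finally show "\<bar>K\<bar> * \<bar>y - x\<bar> \<le> e" .
      qed simp
      finally show ?thesis by simp
    qed
    moreover have "?d > 0" using e by (simp add: add_nonneg_pos)
    ultimately show "\<exists>d>0. \<forall>y\<in>{a..b}. norm (y - x) < d \<longrightarrow> norm (P y - P x - 0) \<le> e * norm (y - x)"
      by blast
  qed
qed (use x y in auto)

text \<open>The product rule is available only almost everywhere, since both primitives are merely
  Lipschitz. Instead the defect of the formula up to time t is shown to have increments of second
  order, hence to be constant.\<close>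

lemma integral_by_parts_primitives:
  fixes h z :: "real \<Rightarrow> 'a::euclidean_space"
  assumes ab: "a \<le> b"
    and h: "h \<in> borel_measurable (lebesgue_on {a..b})" "\<And>t. t \<in> {a..b} \<Longrightarrow> norm (h t) \<le> B"
    and z: "z \<in> borel_measurable (lebesgue_on {a..b})" "\<And>t. t \<in> {a..b} \<Longrightarrow> norm (z t) \<le> C"
  shows "(LINT t|lebesgue_on {a..b}. h t \<bullet> integral {a..t} z) =
    integral {a..b} h \<bullet> integral {a..b} z - (LINT t|lebesgue_on {a..b}. integral {a..t} h \<bullet> z t)"
proof -
  define H where "H t = integral {a..t} h" for t
  define Z where "Z t = integral {a..t} z" for t
  have hi: "integrable (lebesgue_on {a..b}) h" and zi: "integrable (lebesgue_on {a..b}) z"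
    by (rule integrable_bounded_ivl[OF h], assumption, rule integrable_bounded_ivl[OF z])
  have Hc: "continuous_on {a..b} H" and Zc: "continuous_on {a..b} Z"
    unfolding H_def Z_def by (rule continuous_on_primitive[OF hi], rule continuous_on_primitive[OF zi])
  have [measurable]: "H \<in> borel_measurable (lebesgue_on {a..b})" "Z \<in> borel_measurable (lebesgue_on {a..b})"
    "h \<in> borel_measurable (lebesgue_on {a..b})" "z \<in> borel_measurable (lebesgue_on {a..b})"
    by (rule continuous_imp_measurable_on_sets_lebesgue[OF Hc], simp,
        rule continuous_imp_measurable_on_sets_lebesgue[OF Zc], simp, fact h(1), fact z(1))
  obtain MH where MH: "\<And>t. t \<in> {a..b} \<Longrightarrow> norm (H t) \<le> MH"
    using compact_imp_bounded[OF compact_continuous_image[OF Hc]] unfolding bounded_iff by blast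
  obtain MZ where MZ: "\<And>t. t \<in> {a..b} \<Longrightarrow> norm (Z t) \<le> MZ"
    using compact_imp_bounded[OF compact_continuous_image[OF Zc]] unfolding bounded_iff by blast
  have B0: "0 \<le> B" and C0: "0 \<le> C"
    using h(2)[of a] z(2)[of a] ab order_trans[OF norm_ge_zero] by auto
  have hZ: "integrable (lebesgue_on {a..b}) (\<lambda>t. h t \<bullet> (Z t - c))" for c
  proof (rule integrable_bounded_ivl)
    show "norm (h t \<bullet> (Z t - c)) \<le> B * (MZ + norm c)" if "t \<in> {a..b}" for t
      using norm_triangle_ineq4[of "Z t" c] MZ[OF that] h(2)[OF that] B0 unfolding real_norm_def
      by (intro order_trans[OF Cauchy_Schwarz_ineq2] mult_mono) auto
  qed measurable
  have Hz: "integrable (lebesgue_on {a..b}) (\<lambda>t. (H t - c) \<bullet> z t)" for c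
  proof (rule integrable_bounded_ivl)
    show "norm ((H t - c) \<bullet> z t) \<le> (MH + norm c) * C" if "t \<in> {a..b}" for t
      using norm_triangle_ineq4[of "H t" c] MH[OF that] z(2)[OF that] C0
        norm_ge_zero[of "H t"] norm_ge_zero[of c] norm_ge_zero[of "z t"] unfolding real_norm_def
      by (intro order_trans[OF Cauchy_Schwarz_ineq2] mult_mono) linarith+
  qed measurable
  have hio: "h integrable_on {a..b}" and zio: "z integrable_on {a..b}"
    by (rule integrable_on_lebesgue_on[OF hi], simp, rule integrable_on_lebesgue_on[OF zi], simp)
  have hZio: "(\<lambda>t. h t \<bullet> (Z t - c)) integrable_on {a..b}"
    and Hzio: "(\<lambda>t. (H t - c) \<bullet> z t) integrable_on {a..b}" for c
    by (rule integrable_on_lebesgue_on[OF hZ], simp, rule integrable_on_lebesgue_on[OF Hz], simp)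
  \<comment> \<open>The defect of the integration by parts on \<open>{a..t}\<close>; it vanishes at
    \<open>a\<close>.\<close>
  define P where "P t = H t \<bullet> Z t - integral {a..t} (\<lambda>r. h r \<bullet> Z r) - integral {a..t} (\<lambda>r. H r \<bullet> z r)" for t
  have "norm (P t - P s) \<le> (2 * B * C) * (t - s)\<^sup>2" if st: "a \<le> s" "s \<le> t" "t \<le> b" for s t
  proof -
    have sub: "f integrable_on {s..t}" if "f integrable_on {a..b}" for f :: "real \<Rightarrow> 'c::euclidean_space"
      by (rule integrable_on_subinterval[OF that]) (use st in auto)
    have diff: "integral {a..t} f - integral {a..s} f = integral {s..t} f" if "f integrable_on {a..b}" for f :: "real \<Rightarrow> 'c::euclidean_space"
    proof -
      have "f integrable_on {a..t}" by (rule integrable_on_subinterval[OF that]) (use st in auto)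
      then show ?thesis using Henstock_Kurzweil_Integration.integral_combine[of a s t f] st by (auto simp: algebra_simps)
    qed
    have lip: "norm (integral {p..q} h) \<le> B * (q - p)" "norm (integral {p..q} z) \<le> C * (q - p)"
      if "s \<le> p" "p \<le> q" "q \<le> t" for p q
    proof -
      have pq: "{p..q} \<subseteq> {a..b}" using that st by auto
      show "norm (integral {p..q} h) \<le> B * (q - p)"
        by (rule norm_integral_bound_ivl[OF integrable_on_subinterval[OF hio pq] that(2)]) (use pq h(2) in blast)
      show "norm (integral {p..q} z) \<le> C * (q - p)"
        by (rule norm_integral_bound_ivl[OF integrable_on_subinterval[OF zio pq] that(2)]) (use pq z(2) in blast)
    qed
    have dZ: "norm (Z r - Z t) \<le> C * (t - s)" if "r \<in> {s..t}" for r
    proof -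
      have "Z t - Z r = integral {r..t} z"
        unfolding Z_def using Henstock_Kurzweil_Integration.integral_combine[of a r t z] that st
          integrable_on_subinterval[OF zio, of a t] by (auto simp: algebra_simps)
      then have "norm (Z r - Z t) \<le> C * (t - r)" using lip(2)[of r t] that by (metis norm_minus_commute atLeastAtMost_iff order_refl)
      also have "\<dots> \<le> C * (t - s)" using that C0 by (intro mult_left_mono) auto
      finally show ?thesis .
    qed
    have dH: "norm (H r - H s) \<le> B * (t - s)" if "r \<in> {s..t}" for r
    proof -
      have "H r - H s = integral {s..r} h"
        unfolding H_def using Henstock_Kurzweil_Integration.integral_combine[of a s r h] that st
          integrable_on_subinterval[OF hio, of a r] by (auto simp: algebra_simps)
      then have "norm (H r - H s) \<le> B * (r - s)" using lip(1)[of s r] that by simp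
      also have "\<dots> \<le> B * (t - s)" using that B0 by (intro mult_left_mono) auto
      finally show ?thesis .
    qed
    \<comment> \<open>Recentring \<open>Z\<close> at its value in t and \<open>H\<close> at its
      value in s makes both integrands of order \<open>t - s\<close>. The subtracted terms add up to
      exactly \<open>H t \<bullet> Z t - H s \<bullet> Z s\<close>.\<close>
    have e1: "integral {s..t} (\<lambda>r. h r \<bullet> (Z r - Z t)) = integral {s..t} (\<lambda>r. h r \<bullet> Z r) - (H t - H s) \<bullet> Z t"
    proof -
      have "integral {s..t} (\<lambda>r. h r \<bullet> Z t) = integral {s..t} h \<bullet> Z t"
        using integral_linear[OF sub[OF hio] bounded_linear_inner_left[of "Z t"]] by (simp add: o_def)
      moreover have "(\<lambda>r. h r \<bullet> Z t) integrable_on {s..t}"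
        using integrable_linear[OF sub[OF hio] bounded_linear_inner_left[of "Z t"]] by (simp add: o_def)
      ultimately show ?thesis
        using diff[OF hio] sub[OF hZio[of 0]] by (simp add: inner_diff_right integral_diff H_def)
    qed
    have e2: "integral {s..t} (\<lambda>r. (H r - H s) \<bullet> z r) = integral {s..t} (\<lambda>r. H r \<bullet> z r) - H s \<bullet> (Z t - Z s)"
    proof -
      have "integral {s..t} (\<lambda>r. H s \<bullet> z r) = H s \<bullet> integral {s..t} z"
        using integral_linear[OF sub[OF zio] bounded_linear_inner_right[of "H s"]] by (simp add: o_def)
      moreover have "(\<lambda>r. H s \<bullet> z r) integrable_on {s..t}"
        using integrable_linear[OF sub[OF zio] bounded_linear_inner_right[of "H s"]] by (simp add: o_def)
      ultimately show ?thesis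
        using diff[OF zio] sub[OF Hzio[of 0]] by (simp add: inner_diff_left integral_diff Z_def)
    qed
    have "P t - P s = - integral {s..t} (\<lambda>r. h r \<bullet> (Z r - Z t)) - integral {s..t} (\<lambda>r. (H r - H s) \<bullet> z r)"
      unfolding e1 e2 using diff[OF hZio[of 0]] diff[OF Hzio[of 0]] by (simp add: P_def inner_diff_left inner_diff_right)
    moreover have "norm (integral {s..t} (\<lambda>r. h r \<bullet> (Z r - Z t))) \<le> (B * (C * (t - s))) * (t - s)"
    proof (rule norm_integral_bound_ivl)
      fix r assume r: "r \<in> {s..t}"
      then show "norm (h r \<bullet> (Z r - Z t)) \<le> B * (C * (t - s))"
        using dZ[OF r] h(2)[of r] st B0 unfolding real_norm_def
        by (intro order_trans[OF Cauchy_Schwarz_ineq2] mult_mono) auto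
    qed (use st sub hZio in auto)
    moreover have "norm (integral {s..t} (\<lambda>r. (H r - H s) \<bullet> z r)) \<le> ((B * (t - s)) * C) * (t - s)"
    proof (rule norm_integral_bound_ivl)
      fix r assume r: "r \<in> {s..t}"
      then show "norm ((H r - H s) \<bullet> z r) \<le> (B * (t - s)) * C"
        using dH[OF r] z(2)[of r] st B0 unfolding real_norm_def
        by (intro order_trans[OF Cauchy_Schwarz_ineq2] mult_mono) auto
    qed (use st sub Hzio in auto)
    ultimately have "norm (P t - P s) \<le> (B * (C * (t - s))) * (t - s) + ((B * (t - s)) * C) * (t - s)"
      unfolding real_norm_def by linarith
    then show ?thesis by (simp add: power2_eq_square algebra_simps)
  qed
  then have "P b = P a"
    using ab by (intro constant_if_quadratic_modulus[of a b P]) auto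
  then have "H b \<bullet> Z b = integral {a..b} (\<lambda>r. h r \<bullet> Z r) + integral {a..b} (\<lambda>r. H r \<bullet> z r)"
    by (simp add: P_def H_def Z_def)
  moreover have "(LINT t|lebesgue_on {a..b}. h t \<bullet> Z t) = integral {a..b} (\<lambda>r. h r \<bullet> Z r)"
    "(LINT t|lebesgue_on {a..b}. H t \<bullet> z t) = integral {a..b} (\<lambda>r. H r \<bullet> z r)"
    using lebesgue_integral_eq_integral[OF hZ[of 0]] lebesgue_integral_eq_integral[OF Hz[of 0]] by auto
  ultimately show ?thesis by (simp add: H_def Z_def)
qed

section \<open>Weak derivatives\<close>

lemma test_funD:
  assumes "\<eta> \<in> test_fun T" and "T > 0"
  shows "(\<eta> has_real_derivative deriv \<eta> t) (at t)"
    and "continuous_on UNIV (deriv \<eta>)"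
    and "\<eta> 0 = 0" and "\<eta> T = 0"
proof -
  obtain D where D: "\<And>x. (\<eta> has_vector_derivative D x) (at x)" "continuous_on UNIV D"
    using assms(1) by (auto simp: test_fun_def C1_differentiable_on_def)
  have D': "(\<eta> has_real_derivative D x) (at x)" for x
    using D(1) by (simp add: has_real_derivative_iff_has_vector_derivative)
  then have eq: "deriv \<eta> = D" using DERIV_imp_deriv by blast
  show "(\<eta> has_real_derivative deriv \<eta> t) (at t)" "continuous_on UNIV (deriv \<eta>)"
    using D' D(2) eq by auto
  have "closure {t. \<eta> t \<noteq> 0} \<subseteq> {0<..<T}"
    using assms(1) by (simp add: test_fun_def)
  with closure_subset have "{t. \<eta> t \<noteq> 0} \<subseteq> {0<..<T}" by (rule order_trans)
  then show "\<eta> 0 = 0" "\<eta> T = 0" by auto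
qed

lemma test_fun_primitive:
  assumes "\<eta> \<in> test_fun T" and "T > 0" and "t \<in> {0..T}"
  shows "integral {0..t} (\<lambda>r. deriv \<eta> r *\<^sub>R (b::'a::euclidean_space)) = \<eta> t *\<^sub>R b"
proof -
  have "((\<lambda>r. \<eta> r *\<^sub>R b) has_vector_derivative deriv \<eta> r *\<^sub>R b) (at r within {0..t})" for r
    using has_vector_derivative_scaleR[OF has_field_derivative_at_within[OF test_funD(1)[OF assms(1,2)]]
        has_vector_derivative_const[of b]] by simp
  then have "((\<lambda>r. deriv \<eta> r *\<^sub>R b) has_integral (\<eta> t *\<^sub>R b - \<eta> 0 *\<^sub>R b)) {0..t}"
    using assms(3) by (intro fundamental_theorem_of_calculus) auto
  then show ?thesis
    using test_funD(3)[OF assms(1,2)] by (simp add: integral_unique)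
qed

text \<open>Tested against a basis vector b, the claim is the integration by parts with
  \<open>deriv \<eta> t *\<^sub>R b\<close> in the role of h. The primitive of that function is
  \<open>\<eta> t *\<^sub>R b\<close>, which vanishes at T, so the boundary term and the
  contribution of c drop out.\<close>

lemma has_weak_deriv_primitive:
  fixes z :: "real \<Rightarrow> 'a::euclidean_space"
  assumes T: "T > 0"
    and z: "z \<in> borel_measurable (lebesgue_on {0..T})" "\<And>t. t \<in> {0..T} \<Longrightarrow> norm (z t) \<le> C"
    and v: "\<And>t. t \<in> {0..T} \<Longrightarrow> v t = c + integral {0..t} z"
  shows "has_weak_deriv T v z"
  unfolding has_weak_deriv_def
proof
  fix \<eta> assume \<eta>: "\<eta> \<in> test_fun T"
  let ?M = "lebesgue_on {0..T}"
  have zi: "integrable ?M z" by (rule integrable_bounded_ivl[OF z])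
  have dc: "continuous_on {0..T} (deriv \<eta>)"
    using test_funD(2)[OF \<eta> T] by (rule continuous_on_subset) auto
  have \<eta>c: "continuous_on {0..T} \<eta>"
    using test_funD(1)[OF \<eta> T] by (meson DERIV_isCont continuous_at_imp_continuous_on)
  have Zc: "continuous_on {0..T} (\<lambda>t. integral {0..t} z)"
    by (rule continuous_on_primitive[OF zi])
  have vc: "continuous_on {0..T} (\<lambda>t. deriv \<eta> t *\<^sub>R (c + integral {0..t} z))"
    by (intro continuous_intros dc Zc)
  have \<eta>m[measurable]: "\<eta> \<in> borel_measurable ?M" and zm[measurable]: "z \<in> borel_measurable ?M"
    by (rule continuous_imp_measurable_on_sets_lebesgue[OF \<eta>c], simp, fact z(1))
  obtain E where E: "\<And>t. t \<in> {0..T} \<Longrightarrow> norm (\<eta> t) \<le> E"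
    using compact_imp_bounded[OF compact_continuous_image[OF \<eta>c]] unfolding bounded_iff by blast
  have "0 \<le> E" using E[of 0] T norm_ge_zero[of "\<eta> 0"] by (auto simp del: norm_ge_zero)
  then have \<eta>z: "integrable ?M (\<lambda>t. \<eta> t *\<^sub>R z t)"
    using E z(2) by (intro integrable_bounded_ivl[where B="E * C"]) (auto intro!: mult_mono)
  show "(LINT t|?M. deriv \<eta> t *\<^sub>R v t) = - (LINT t|?M. \<eta> t *\<^sub>R z t)"
  proof (rule euclidean_eqI)
    fix b :: 'a assume b: "b \<in> Basis"
    let ?h = "\<lambda>t. deriv \<eta> t *\<^sub>R b"
    have hc: "continuous_on {0..T} ?h" by (intro continuous_intros dc)
    obtain B where B: "\<And>t. t \<in> {0..T} \<Longrightarrow> norm (?h t) \<le> B"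
      using compact_imp_bounded[OF compact_continuous_image[OF hc]] unfolding bounded_iff by blast
    have hm: "?h \<in> borel_measurable ?M"
      by (rule continuous_imp_measurable_on_sets_lebesgue[OF hc]) simp
    have "(LINT t|?M. ?h t \<bullet> integral {0..t} z) =
        integral {0..T} ?h \<bullet> integral {0..T} z - (LINT t|?M. integral {0..t} ?h \<bullet> z t)"
      using T by (intro integral_by_parts_primitives[OF _ hm B z]) auto
    also have "integral {0..T} ?h = 0"
      using test_fun_primitive[OF \<eta> T, of T b] test_funD(4)[OF \<eta> T] T by simp
    also have "(LINT t|?M. integral {0..t} ?h \<bullet> z t) = (LINT t|?M. (\<eta> t *\<^sub>R z t) \<bullet> b)"
      using test_fun_primitive[OF \<eta> T, of _ b] by (intro Bochner_Integration.integral_cong) (auto simp: inner_commute)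
    finally have 1: "(LINT t|?M. ?h t \<bullet> integral {0..t} z) = - (LINT t|?M. (\<eta> t *\<^sub>R z t) \<bullet> b)"
      by simp
    have "(LINT t|?M. (deriv \<eta> t *\<^sub>R v t) \<bullet> b) = (LINT t|?M. ?h t \<bullet> c + ?h t \<bullet> integral {0..t} z)"
      using v by (intro Bochner_Integration.integral_cong) (auto simp: inner_commute inner_add_left algebra_simps)
    also have "\<dots> = (LINT t|?M. ?h t \<bullet> c) + (LINT t|?M. ?h t \<bullet> integral {0..t} z)"
      by (intro Bochner_Integration.integral_add integrable_continuous_ivl continuous_intros hc Zc)
    also have "(LINT t|?M. ?h t \<bullet> c) = 0"
    proof -
      have "(LINT t|?M. ?h t \<bullet> c) = (LINT t|?M. ?h t) \<bullet> c"
        by (intro integral_inner_left integrable_continuous_ivl hc)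
      also have "(LINT t|?M. ?h t) = integral {0..T} ?h"
        by (intro lebesgue_integral_eq_integral integrable_continuous_ivl hc) simp
      finally show ?thesis using \<open>integral {0..T} ?h = 0\<close> by simp
    qed
    finally have 2: "(LINT t|?M. (deriv \<eta> t *\<^sub>R v t) \<bullet> b) = - (LINT t|?M. (\<eta> t *\<^sub>R z t) \<bullet> b)"
      using 1 by simp
    have "integrable ?M (\<lambda>t. deriv \<eta> t *\<^sub>R v t) =
        integrable ?M (\<lambda>t. deriv \<eta> t *\<^sub>R (c + integral {0..t} z))"
      by (rule Bochner_Integration.integrable_cong) (auto simp: v)
    with integrable_continuous_ivl[OF vc] have "integrable ?M (\<lambda>t. deriv \<eta> t *\<^sub>R v t)" by simp
    then show "(LINT t|?M. deriv \<eta> t *\<^sub>R v t) \<bullet> b = - (LINT t|?M. \<eta> t *\<^sub>R z t) \<bullet> b"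
      using 2 \<eta>z by (simp add: integral_inner_left[symmetric] del: integral_inner_left inner_scaleR_left)
  qed
qed

section \<open>The du Bois-Reymond lemma and the recovery of a function from its weak
  derivative\<close>

text \<open>The primitive from 0 vanishes to the left of the support of \<xi>, and to its right
  because the mean is zero. The margin e gives a support that is compact in the open
  interval.\<close>

lemma test_fun_of_mean_zero:
  assumes T: "T > 0" and e: "0 < e" "e < T / 2" and c: "continuous_on UNIV \<xi>"
    and z: "\<And>t. t \<notin> {e..T-e} \<Longrightarrow> \<xi> t = 0" and m: "integral {0..T} \<xi> = 0"
  obtains \<eta> where "\<eta> \<in> test_fun T" "\<And>t. deriv \<eta> t = \<xi> t"
proof
  define \<eta> where "\<eta> t = integral {0..t} \<xi>" for t
  have ci: "\<xi> integrable_on {a..b}" for a b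
    using c by (intro integrable_continuous_real continuous_on_subset[OF c]) auto
  have zero: "integral {a..b} \<xi> = 0" if "b \<le> e \<or> T - e \<le> a" for a b
  proof -
    have "integral {a..b} \<xi> = integral {a..b} (\<lambda>_. 0)"
    proof (rule integral_spike[of "{e, T-e}"])
      fix x assume "x \<in> {a..b} - {e, T-e}"
      then show "0 = \<xi> x" using that z[of x] by auto
    qed simp
    then show ?thesis by simp
  qed
  have d: "(\<eta> has_vector_derivative \<xi> t) (at t)" for t
  proof -
    \<comment> \<open>Differentiability is required on the whole line, but for negative x the
      integral over \<open>{0..x}\<close> is 0 by convention. As \<xi> vanishes below e, integrating
      from a base point left of 0 and t gives the same function on both sides of 0.\<close>
    let ?a = "min 0 t - 1" and ?b = "max 0 t + 1"
    have 1: "((\<lambda>x. integral {?a..x} \<xi>) has_vector_derivative \<xi> t) (at t within {?a<..<?b})"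
      by (rule has_vector_derivative_within_subset[OF integral_has_vector_derivative[of ?a ?b]])
         (auto intro: continuous_on_subset[OF c])
    have 2: "integral {?a..x} \<xi> = \<eta> x" if "x \<in> {?a<..<?b}" for x
    proof (cases "0 \<le> x")
      case True
      have "integral {?a..0} \<xi> + integral {0..x} \<xi> = integral {?a..x} \<xi>"
        by (rule Henstock_Kurzweil_Integration.integral_combine) (use True ci in auto)
      then show ?thesis using zero[of 0 ?a] e by (simp add: \<eta>_def)
    next
      case False
      then show ?thesis using zero[of x ?a] e by (simp add: \<eta>_def)
    qed
    have "(\<eta> has_vector_derivative \<xi> t) (at t within {?a<..<?b})"
      by (rule has_vector_derivative_transform[OF _ _ 1]) (use 2 in auto)
    then show ?thesis by (subst (asm) has_vector_derivative_within_open) auto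
  qed
  have "\<eta> t = 0" if "t \<notin> {e..T-e}" for t
  proof (cases "t < e")
    case True
    then show ?thesis using zero[of t 0] by (simp add: \<eta>_def)
  next
    case False
    then have t: "T - e < t" using that by auto
    have "integral {0..T-e} \<xi> + integral {T-e..T} \<xi> = integral {0..T} \<xi>"
      "integral {0..T-e} \<xi> + integral {T-e..t} \<xi> = integral {0..t} \<xi>"
      by (rule Henstock_Kurzweil_Integration.integral_combine; use t e T ci in auto)+
    then show ?thesis using zero[of T "T-e"] zero[of t "T-e"] m by (simp add: \<eta>_def)
  qed
  then have "{t. \<eta> t \<noteq> 0} \<subseteq> {e..T-e}" by blast
  then have "closure {t. \<eta> t \<noteq> 0} \<subseteq> {e..T-e}"
    by (rule closure_minimal) simp
  then show "\<eta> \<in> test_fun T"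
    using d c e by (auto simp: test_fun_def C1_differentiable_on_def)
  show "deriv \<eta> t = \<xi> t" for t
    using d by (simp add: DERIV_imp_deriv has_real_derivative_iff_has_vector_derivative)
qed

text \<open>The test function has derivative \<open>\<kappa> (y - m)\<close>, where \<open>\<kappa>\<close> is a cutoff and \<open>m\<close> the
  \<open>\<kappa>\<close>-weighted mean of \<open>y\<close>.\<close>

lemma du_Bois_Reymond_inner:
  fixes y :: "real \<Rightarrow> real"
  assumes T: "T > 0" and y: "continuous_on {0..T} y"
    and o: "\<And>\<eta>. \<eta> \<in> test_fun T \<Longrightarrow> (LINT t|lebesgue_on {0..T}. deriv \<eta> t * y t) = 0"
    and e: "0 < e" "e < T / 2"
  shows "\<exists>m. \<forall>t\<in>{e<..<T-e}. y t = m"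
proof -
  \<comment> \<open>The cutoff is positive exactly on the open interval from e to
    \<open>T - e\<close>.\<close>
  define k where "k t = max 0 ((t - e) * (T - e - t))" for t
  \<comment> \<open>Clamping to \<open>{0..T}\<close> extends y continuously to the line, where test
    functions live.\<close>
  define p where "p t = max 0 (min T t)" for t :: real
  define Y where "Y t = y (p t)" for t
  have pc: "continuous_on UNIV p" unfolding p_def by (intro continuous_intros)
  have Yc: "continuous_on UNIV Y" unfolding Y_def
    by (rule continuous_on_compose2[OF y pc]) (use T in \<open>auto simp: p_def\<close>)
  have kc: "continuous_on UNIV k" unfolding k_def by (intro continuous_intros)
  have YY: "Y t = y t" if "t \<in> {0..T}" for t using that by (auto simp: Y_def p_def)
  have kz: "k t = 0" if "t \<notin> {e..T-e}" for t
  proof -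
    have "(t - e) * (T - e - t) \<le> 0" using that e by (auto simp: mult_le_0_iff)
    then show ?thesis by (simp add: k_def)
  qed
  have kp: "k t > 0" if "t \<in> {e<..<T-e}" for t
    using that by (auto simp: k_def less_max_iff_disj)
  have k0: "k t \<ge> 0" for t by (simp add: k_def)
  have ci: "f integrable_on {0..T}" if "continuous_on UNIV f" for f :: "real \<Rightarrow> real"
    by (intro integrable_continuous_real continuous_on_subset[OF that]) auto
  have pos: "integral {0..T} k > 0"
  proof -
    have "integral {0..T} k \<ge> 0" by (intro integral_nonneg ci kc) (use k0 in auto)
    moreover have "integral {0..T} k \<noteq> 0"
    proof
      assume "integral {0..T} k = 0"
      then have "k (T/2) = 0"
        using integral_eq_0_iff[of 0 T k] k0 continuous_on_subset[OF kc, of "{0..T}"] T by auto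
      then show False using kp[of "T/2"] e by auto
    qed
    ultimately show ?thesis by simp
  qed
  define m where "m = integral {0..T} (\<lambda>t. k t * Y t) / integral {0..T} k"
  define \<xi> where "\<xi> t = k t * (Y t - m)" for t
  have \<xi>c: "continuous_on UNIV \<xi>" unfolding \<xi>_def by (intro continuous_intros kc Yc)
  have "integral {0..T} \<xi> = integral {0..T} (\<lambda>t. k t * Y t) - integral {0..T} (\<lambda>t. k t * m)"
    unfolding \<xi>_def right_diff_distrib by (intro integral_diff ci continuous_intros kc Yc)
  also have "\<dots> = 0" using pos by (simp add: m_def)
  finally have \<xi>0: "integral {0..T} \<xi> = 0" .
  obtain \<eta> where \<eta>: "\<eta> \<in> test_fun T" "\<And>t. deriv \<eta> t = \<xi> t"
    using test_fun_of_mean_zero[OF T e \<xi>c _ \<xi>0] kz by (auto simp: \<xi>_def)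
  have q0: "k t * (Y t - m)\<^sup>2 \<ge> 0" for t using k0 by simp
  \<comment> \<open>Both terms on the right vanish: the first is the hypothesis tested with the
    primitive of \<xi>, the second is m times the zero mean of \<xi>. A continuous non-negative
    function with integral zero is zero.\<close>
  have "integral {0..T} (\<lambda>t. k t * (Y t - m)\<^sup>2) = integral {0..T} (\<lambda>t. \<xi> t * Y t) - integral {0..T} (\<lambda>t. \<xi> t * m)"
    by (subst integral_diff[symmetric])
       (auto intro!: ci continuous_intros \<xi>c Yc kc integral_cong simp: \<xi>_def power2_eq_square algebra_simps)
  also have "integral {0..T} (\<lambda>t. \<xi> t * m) = 0" using \<xi>0 by simp
  also have "integral {0..T} (\<lambda>t. \<xi> t * Y t) = (LINT t|lebesgue_on {0..T}. \<xi> t * Y t)"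
    by (intro lebesgue_integral_eq_integral[symmetric] integrable_continuous_ivl
        continuous_on_subset[OF continuous_on_mult[OF \<xi>c Yc]]) auto
  also have "\<dots> = (LINT t|lebesgue_on {0..T}. deriv \<eta> t * y t)"
    by (intro Bochner_Integration.integral_cong) (auto simp: \<eta> YY)
  also have "\<dots> = 0" by (rule o[OF \<eta>(1)])
  finally have "integral {0..T} (\<lambda>t. k t * (Y t - m)\<^sup>2) = 0" by simp
  moreover have "continuous_on {0..T} (\<lambda>t. k t * (Y t - m)\<^sup>2)"
    by (intro continuous_on_subset[where t="{0..T}" and s=UNIV] continuous_intros kc Yc) auto
  ultimately have z: "k t * (Y t - m)\<^sup>2 = 0" if "t \<in> {0..T}" for t
    using integral_eq_0_iff[of 0 T "\<lambda>t. k t * (Y t - m)\<^sup>2"] q0 T that by auto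
  have "y t = m" if "t \<in> {e<..<T-e}" for t
    using z[of t] kp[OF that] that e YY[of t] by auto
  then show ?thesis by blast
qed

text \<open>The constant found on an inner interval could depend on e. Each such interval used here
  contains the midpoint, which fixes the value, and continuity reaches the end points.\<close>

lemma du_Bois_Reymond:
  fixes y :: "real \<Rightarrow> real"
  assumes T: "T > 0" and y: "continuous_on {0..T} y"
    and o: "\<And>\<eta>. \<eta> \<in> test_fun T \<Longrightarrow> (LINT t|lebesgue_on {0..T}. deriv \<eta> t * y t) = 0"
    and t: "t \<in> {0..T}"
  shows "y t = y 0"
proof -
  have mid: "y s = y (T/2)" if s: "s \<in> {0<..<T}" for s
  proof -
    \<comment> \<open>The outer halving puts s strictly inside and keeps e at most
      \<open>T/4\<close>, so that the midpoint is inside as well.\<close>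
    define e where "e = min (min s (T - s)) (T/2) / 2"
    have "e \<le> s/2" "e \<le> (T - s)/2" "e \<le> T/4" "0 < e"
      using s T by (auto simp: e_def min_def)
    then have "0 < e" "e < T/2" "s \<in> {e<..<T-e}" "T/2 \<in> {e<..<T-e}"
      using s T by auto
    then show ?thesis using du_Bois_Reymond_inner[OF T y o, of e] by auto
  qed
  have c: "closure {0<..<T} = {0..T}" using T by simp
  have "y s = y (T/2)" if "s \<in> {0..T}" for s
    by (rule continuous_constant_on_closure[of "{0<..<T}"]) (unfold c, fact y, fact mid, fact that)
  from this[OF t] this[of 0] T show ?thesis by simp
qed

text \<open>The primitive of w also has weak derivative w, so every component of the difference from
  v is orthogonal to all \<open>deriv \<eta>\<close> and is therefore constant.\<close>

lemma weak_deriv_FTC: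
  fixes v w :: "real \<Rightarrow> 'a::euclidean_space"
  assumes T: "T > 0" and v: "v \<in> C0 T"
    and w: "w \<in> borel_measurable (lebesgue_on {0..T})" "\<And>t. t \<in> {0..T} \<Longrightarrow> norm (w t) \<le> C"
    and wd: "has_weak_deriv T v w" and t: "t \<in> {0..T}"
  shows "v t = v 0 + integral {0..t} w"
proof (rule euclidean_eqI)
  fix b :: 'a assume b: "b \<in> Basis"
  let ?M = "lebesgue_on {0..T}"
  have vc: "continuous_on {0..T} v" using v by (simp add: C0_def)
  have Wc: "continuous_on {0..T} (\<lambda>t. integral {0..t} w)"
    by (intro continuous_on_primitive integrable_bounded_ivl[OF w])
  define y where "y t = (v t - integral {0..t} w) \<bullet> b" for t
  have yc: "continuous_on {0..T} y" unfolding y_def by (intro continuous_intros vc Wc)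
  have "(LINT t|?M. deriv \<eta> t * y t) = 0" if \<eta>: "\<eta> \<in> test_fun T" for \<eta>
  proof -
    have dc: "continuous_on {0..T} (deriv \<eta>)"
      using test_funD(2)[OF \<eta> T] by (rule continuous_on_subset) auto
    have i: "integrable ?M (\<lambda>t. deriv \<eta> t *\<^sub>R v t)" "integrable ?M (\<lambda>t. deriv \<eta> t *\<^sub>R integral {0..t} w)"
      by (intro integrable_continuous_ivl continuous_intros dc vc Wc)+
    have "has_weak_deriv T (\<lambda>t. integral {0..t} w) w"
      by (rule has_weak_deriv_primitive[OF T w, where c=0]) auto
    then have "(LINT t|?M. deriv \<eta> t *\<^sub>R v t) - (LINT t|?M. deriv \<eta> t *\<^sub>R integral {0..t} w) = 0"
      using wd \<eta> by (simp add: has_weak_deriv_def)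
    then have "(LINT t|?M. deriv \<eta> t *\<^sub>R v t - deriv \<eta> t *\<^sub>R integral {0..t} w) \<bullet> b = 0"
      using i by simp
    then have "(LINT t|?M. (deriv \<eta> t *\<^sub>R v t - deriv \<eta> t *\<^sub>R integral {0..t} w) \<bullet> b) = 0"
      using i by (subst integral_inner_left) auto
    then show ?thesis by (simp add: y_def algebra_simps)
  qed
  from du_Bois_Reymond[OF T yc this t]
  show "v t \<bullet> b = (v 0 + integral {0..t} w) \<bullet> b"
    by (simp add: y_def algebra_simps)
qed

text \<open>Lebesgue differentiation: the difference has integral zero over every subinterval, and
  at almost every point it is the limit of its averages over intervals to the right.\<close>

lemma AE_eq_if_primitives_eq:
  fixes f g :: "real \<Rightarrow> 'a::euclidean_space"
  assumes f: "integrable (lebesgue_on {0..T}) f" and g: "integrable (lebesgue_on {0..T}) g"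
    and eq: "\<And>t. t \<in> {0..T} \<Longrightarrow> integral {0..t} f = integral {0..t} g"
  shows "AE t in lebesgue_on {0..T}. f t = g t"
proof -
  define d where "d t = (if t \<in> {0..T} then f t - g t else 0)" for t
  have i: "f integrable_on {0..T}" "g integrable_on {0..T}"
    by (rule integrable_on_lebesgue_on[OF f], simp, rule integrable_on_lebesgue_on[OF g], simp)
  have dT: "(\<lambda>t. f t - g t) integrable_on {0..T}" by (intro integrable_diff i)
  have "d = (\<lambda>t. if t \<in> {0..T} then f t - g t else 0)" by (simp add: d_def fun_eq_iff)
  then have "d integrable_on UNIV" by (simp only: integrable_restrict_UNIV dT)
  then have "d integrable_on cbox a b" for a b
    by (rule integrable_on_subcbox) auto
  then obtain N where N: "negligible N" "\<And>x e. x \<notin> N \<Longrightarrow> 0 < e \<Longrightarrow>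
      \<exists>k>0. \<forall>h. 0 < h \<and> h < k \<longrightarrow> norm (integral (cbox x (x + h *\<^sub>R One)) d /\<^sub>R h ^ DIM(real) - d x) < e"
    using integrable_ccontinuous_explicit[of d] by metis
  have zero: "integral {x..y} d = 0" if xy: "0 \<le> x" "x \<le> y" "y \<le> T" for x y
  proof -
    have sub: "{0..y} \<subseteq> {0..T}" "{x..y} \<subseteq> {0..T}" using xy by auto
    note s = integrable_on_subinterval[OF i(1) sub(1)] integrable_on_subinterval[OF i(2) sub(1)]
      integrable_on_subinterval[OF i(1) sub(2)] integrable_on_subinterval[OF i(2) sub(2)]
    have "integral {x..y} d = integral {x..y} (\<lambda>t. f t - g t)"
      by (rule integral_cong) (use xy in \<open>auto simp: d_def\<close>)
    also have "\<dots> = integral {x..y} f - integral {x..y} g"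
      by (intro integral_diff s)
    also have "integral {x..y} f = integral {x..y} g"
    proof -
      have "integral {0..x} f + integral {x..y} f = integral {0..x} g + integral {x..y} g"
        using Henstock_Kurzweil_Integration.integral_combine[OF xy(1,2) s(1)]
          Henstock_Kurzweil_Integration.integral_combine[OF xy(1,2) s(2)] xy eq[of y] by simp
      then show ?thesis using eq[of x] xy by simp
    qed
    also have "\<dots> - \<dots> = 0" by simp
    finally show ?thesis .
  qed
  \<comment> \<open>The point T is discarded because right-hand intervals starting there leave
    \<open>{0..T}\<close>.\<close>
  have "f x = g x" if x: "x \<in> {0..T}" "x \<notin> N \<union> {T}" for x
  proof -
    have "d x = 0"
    proof (rule ccontr)
      assume "d x \<noteq> 0"
      then obtain k where k: "k > 0" "\<And>h. 0 < h \<Longrightarrow> h < k \<Longrightarrow>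
          norm (integral (cbox x (x + h *\<^sub>R One)) d /\<^sub>R h ^ DIM(real) - d x) < norm (d x)"
        using N(2)[of x "norm (d x)"] x by auto
      define h where "h = min (k/2) (T - x)"
      have h: "0 < h" "h < k" "x + h \<le> T" using k x by (auto simp: h_def min_def)
      have "integral (cbox x (x + h *\<^sub>R One)) d = 0"
        using zero[of x "x+h"] h x by simp
      then show False using k(2)[OF h(1,2)] by simp
    qed
    then show ?thesis using x by (simp add: d_def)
  qed
  moreover have "N \<union> {T} \<in> null_sets lebesgue"
    using N(1) by (simp add: negligible_iff_null_sets[symmetric])
  ultimately have "AE t in lebesgue. t \<in> {0..T} \<longrightarrow> f t = g t"
    by (intro AE_I'[of "N \<union> {T}"]) auto
  then show ?thesis by (subst AE_restrict_space_iff) auto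
qed

section \<open>Bounded representatives and membership in \<open>K_set\<close>\<close>

lemma has_weak_deriv_cong_AE:
  fixes v g w :: "real \<Rightarrow> 'a::euclidean_space"
  assumes "has_weak_deriv T v g" "T > 0"
    and [measurable]: "g \<in> borel_measurable (lebesgue_on {0..T})" "w \<in> borel_measurable (lebesgue_on {0..T})"
    and ae: "AE t in lebesgue_on {0..T}. g t = w t"
  shows "has_weak_deriv T v w"
  unfolding has_weak_deriv_def
proof
  fix \<eta> assume \<eta>: "\<eta> \<in> test_fun T"
  have "continuous_on {0..T} \<eta>"
    using test_funD(1)[OF \<eta> assms(2)] by (meson DERIV_isCont continuous_at_imp_continuous_on)
  then have [measurable]: "\<eta> \<in> borel_measurable (lebesgue_on {0..T})"
    by (rule continuous_imp_measurable_on_sets_lebesgue) simp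
  have "(LINT t|lebesgue_on {0..T}. \<eta> t *\<^sub>R g t) = (LINT t|lebesgue_on {0..T}. \<eta> t *\<^sub>R w t)"
    by (rule integral_cong_AE) (use ae in auto)
  then show "(LINT t|lebesgue_on {0..T}. deriv \<eta> t *\<^sub>R v t) = - (LINT t|lebesgue_on {0..T}. \<eta> t *\<^sub>R w t)"
    using assms(1) \<eta> by (simp add: has_weak_deriv_def)
qed

text \<open>Values above the bound are replaced by 0. A bound valid everywhere keeps
  \<open>\<Phi>\<close> on its closed ball and allows pointwise estimates without null sets.\<close>

lemma Linf_bounded_representative:
  fixes g :: "real \<Rightarrow> 'a::euclidean_space"
  assumes g: "g \<in> borel_measurable (lebesgue_on {0..T})" and B: "norm_Linf T g \<le> ereal B" "0 \<le> B"
  obtains w where "w \<in> borel_measurable (lebesgue_on {0..T})" "\<And>t. norm (w t) \<le> B"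
    "AE t in lebesgue_on {0..T}. g t = w t"
proof
  define w where "w t = (if norm (g t) \<le> B then g t else 0)" for t
  show "w \<in> borel_measurable (lebesgue_on {0..T})" unfolding w_def using g by measurable
  show "norm (w t) \<le> B" for t using B(2) by (simp add: w_def)
  have "AE t in lebesgue_on {0..T}. ereal (norm (g t)) \<le> norm_Linf T g"
    unfolding norm_Linf_def by (rule esssup_AE)
  then show "AE t in lebesgue_on {0..T}. g t = w t"
  proof eventually_elim
    case (elim t)
    then have "ereal (norm (g t)) \<le> ereal B" using B(1) by (rule order_trans)
    then show ?case by (simp add: w_def)
  qed
qed

lemma weak_deriv_in:
  assumes "v \<in> W1inf T"
  shows "weak_deriv T v \<in> Linf T" "has_weak_deriv T v (weak_deriv T v)"
  using someI_ex[of "\<lambda>g. g \<in> Linf T \<and> has_weak_deriv T v g"] assms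
  by (auto simp: weak_deriv_def W1inf_def)

lemma K_setD:
  fixes v :: "real \<Rightarrow> 'a::euclidean_space"
  assumes v: "v \<in> K_set T a" and T: "T > 0" and a: "a > 0"
  obtains w where "w \<in> borel_measurable (lebesgue_on {0..T})" "\<And>t. norm (w t) \<le> a"
    "\<And>t. t \<in> {0..T} \<Longrightarrow> v t = v 0 + integral {0..t} w"
    "AE t in lebesgue_on {0..T}. weak_deriv T v t = w t"
proof -
  have vW: "v \<in> W1inf T" and vC: "v \<in> C0 T" and n: "norm_Linf T (weak_deriv T v) \<le> ereal a"
    using v by (auto simp: K_set_def W1inf_def)
  have m: "weak_deriv T v \<in> borel_measurable (lebesgue_on {0..T})"
    using weak_deriv_in(1)[OF vW] by (simp add: Linf_def)
  obtain w where w: "w \<in> borel_measurable (lebesgue_on {0..T})" "\<And>t. norm (w t) \<le> a"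
      "AE t in lebesgue_on {0..T}. weak_deriv T v t = w t"
    using Linf_bounded_representative[OF m n] a by auto
  have "has_weak_deriv T v w"
    using has_weak_deriv_cong_AE[OF weak_deriv_in(2)[OF vW] T m w(1,3)] .
  then show thesis
    using weak_deriv_FTC[OF T vC w(1,2)] w that by blast
qed

text \<open>\<open>weak_deriv\<close> picks an unspecified weak derivative, so knowing that q is one
  does not suffice. Both have v as primitive up to a constant and hence agree almost everywhere;
  only then does the bound pass from q to the chosen one.\<close>

lemma K_setI:
  fixes v q :: "real \<Rightarrow> 'a::euclidean_space"
  assumes T: "T > 0" and a: "a > 0"
    and q: "q \<in> borel_measurable (lebesgue_on {0..T})" "\<And>t. t \<in> {0..T} \<Longrightarrow> norm (q t) \<le> a"
    and v: "\<And>t. t \<in> {0..T} \<Longrightarrow> v t = c + integral {0..t} q"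
  shows "v \<in> K_set T a" and "AE t in lebesgue_on {0..T}. weak_deriv T v t = q t"
proof -
  have qi: "integrable (lebesgue_on {0..T}) q" by (rule integrable_bounded_ivl[OF q])
  have "continuous_on {0..T} (\<lambda>t. c + integral {0..t} q)"
    by (intro continuous_intros continuous_on_primitive qi)
  then have vC: "v \<in> C0 T" using v continuous_on_cong[of "{0..T}" "{0..T}" v "\<lambda>t. c + integral {0..t} q"]
    by (simp add: C0_def)
  have wd: "has_weak_deriv T v q" by (rule has_weak_deriv_primitive[OF T q v])
  have nq: "norm_Linf T q \<le> ereal a"
    unfolding norm_Linf_def by (rule esssup_I) (use q in \<open>auto intro!: AE_I2\<close>)
  then have "q \<in> Linf T" using q(1) by (auto simp: Linf_def)
  with vC wd have vW: "v \<in> W1inf T" by (auto simp: W1inf_def)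
  have m: "weak_deriv T v \<in> borel_measurable (lebesgue_on {0..T})" "norm_Linf T (weak_deriv T v) < \<infinity>"
    using weak_deriv_in(1)[OF vW] by (auto simp: Linf_def)
  \<comment> \<open>Membership in \<open>Linf\<close> yields only some finite bound at this stage,
    enough for a bounded representative of the chosen derivative.\<close>
  obtain B where B: "norm_Linf T (weak_deriv T v) \<le> ereal B" "0 \<le> B"
  proof (cases "norm_Linf T (weak_deriv T v)")
    case (real r)
    then show thesis using that[of "max r 0"] by auto
  next
    case PInf then show thesis using m by simp
  next
    case MInf then show thesis using that[of 0] by simp
  qed
  obtain w where w: "w \<in> borel_measurable (lebesgue_on {0..T})" "\<And>t. norm (w t) \<le> B"
      "AE t in lebesgue_on {0..T}. weak_deriv T v t = w t"
    using Linf_bounded_representative[OF m(1) B] by auto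
  have wd': "has_weak_deriv T v w"
    using has_weak_deriv_cong_AE[OF weak_deriv_in(2)[OF vW] T m(1) w(1,3)] .
  have "AE t in lebesgue_on {0..T}. w t = q t"
  proof (rule AE_eq_if_primitives_eq)
    show "integrable (lebesgue_on {0..T}) w" by (rule integrable_bounded_ivl[OF w(1,2)])
    show "integral {0..t} w = integral {0..t} q" if "t \<in> {0..T}" for t
      using weak_deriv_FTC[OF T vC w(1,2) wd' that] weak_deriv_FTC[OF T vC q wd that] by simp
  qed (rule qi)
  with w(3) show ae: "AE t in lebesgue_on {0..T}. weak_deriv T v t = q t" by eventually_elim simp
  have "norm_Linf T (weak_deriv T v) = norm_Linf T q"
    unfolding norm_Linf_def by (rule esssup_AE_cong) (use m(1) q(1) ae in auto)
  with nq vW show "v \<in> K_set T a" by (simp add: K_set_def)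
qed

section \<open>The Frechet derivative of the force term\<close>

lemma GDERIV_unique: "GDERIV f x :> D \<Longrightarrow> GDERIV f x :> E \<Longrightarrow> D = E"
  unfolding gderiv_def by (drule (1) has_derivative_unique) (metis inner_commute vector_eq_rdot)

lemma GDERIV_gradient: "GDERIV f x :> D \<Longrightarrow> GDERIV f x :> gradient f x"
  unfolding gradient_def by (rule theI) (auto intro: GDERIV_unique)

lemma DERIV_along_line:
  assumes "GDERIV f (x + r *\<^sub>R y) :> D"
  shows "((\<lambda>r. f (x + r *\<^sub>R y)) has_real_derivative (D \<bullet> y)) (at r)"
proof -
  have "((\<lambda>r. x + r *\<^sub>R y) has_derivative (\<lambda>h. h *\<^sub>R y)) (at r)"
    by (auto intro!: derivative_eq_intros)
  from diff_chain_at[OF this assms[unfolded gderiv_def]]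
  have "((\<lambda>r. f (x + r *\<^sub>R y)) has_derivative (\<lambda>h. (h *\<^sub>R y) \<bullet> D)) (at r)"
    by (simp add: o_def)
  also have "(\<lambda>h. (h *\<^sub>R y) \<bullet> D) = (*) (D \<bullet> y)"
    by (simp add: fun_eq_iff inner_commute)
  finally show ?thesis unfolding has_field_derivative_def .
qed

lemma lebesgue_integral_bound_ivl:
  fixes f :: "real \<Rightarrow> 'a::euclidean_space"
  assumes "continuous_on {a..b} f" "a \<le> b" "\<And>t. t \<in> {a..b} \<Longrightarrow> norm (f t) \<le> B"
  shows "norm (LINT t|lebesgue_on {a..b}. f t) \<le> B * (b - a)"
proof -
  have i: "integrable (lebesgue_on {a..b}) f" by (rule integrable_continuous_ivl[OF assms(1)])
  have "f integrable_on {a..b}" by (rule integrable_continuous_real[OF assms(1)])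
  then show ?thesis
    using lebesgue_integral_eq_integral[OF i] norm_integral_bound_ivl[OF _ assms(2,3)] by simp
qed

lemma norm_le_norm_C:
  assumes "h \<in> C0 T" "t \<in> {0..T}"
  shows "norm (h t) \<le> norm_C T h"
proof -
  have "continuous_on {0..T} (\<lambda>t. norm (h t))"
    using assms(1) by (auto simp: C0_def intro: continuous_intros)
  then have "bdd_above ((\<lambda>t. norm (h t)) ` {0..T})"
    by (intro bounded_imp_bdd_above compact_imp_bounded compact_continuous_image) auto
  then show ?thesis unfolding norm_C_def by (rule cSUP_upper[OF assms(2)])
qed

lemma norm_C_nonneg: "h \<in> C0 T \<Longrightarrow> T > 0 \<Longrightarrow> 0 \<le> norm_C T h"
  using norm_le_norm_C[of h T 0] order_trans[OF norm_ge_zero[of "h 0"]] by auto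

lemma norm_C_scale_le:
  assumes "h \<in> C0 T" "T > 0"
  shows "norm_C T (\<lambda>t. c *\<^sub>R h t) \<le> \<bar>c\<bar> * norm_C T h"
  unfolding norm_C_def[of T "\<lambda>t. c *\<^sub>R h t"]
  by (rule cSUP_least) (use assms norm_le_norm_C[OF assms(1)] in \<open>auto intro: mult_left_mono\<close>)

text \<open>Both expansions are compared at a small multiple c of h. By linearity c cancels, and D
  is bounded by half of itself. Uniqueness is what gives the chosen \<open>frechet_deriv_C\<close> a
  computable value.\<close>

lemma has_frechet_deriv_C_unique:
  assumes T: "T > 0" and L: "has_frechet_deriv_C T G u L" and M: "has_frechet_deriv_C T G u M"
    and h: "h \<in> C0 T"
  shows "L h = M h"
proof (rule ccontr)
  assume ne: "L h \<noteq> M h"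
  define D n where "D = \<bar>L h - M h\<bar>" and "n = norm_C T h"
  have D: "D > 0" using ne by (simp add: D_def)
  have n: "n \<ge> 0" using norm_C_nonneg[OF h T] by (simp add: n_def)
  \<comment> \<open>The factor 4 leaves \<open>D / 2\<close> at the end; \<open>n + 1\<close>
    replaces n because the norm of h may be 0.\<close>
  define e where "e = D / (4 * (n + 1))"
  have e: "e > 0" using D n by (simp add: e_def)
  obtain d1 where d1: "d1 > 0" "\<forall>k\<in>C0 T. norm_C T k < d1 \<longrightarrow> \<bar>G (\<lambda>t. u t + k t) - G u - L k\<bar> \<le> e * norm_C T k"
    using L e unfolding has_frechet_deriv_C_def by blast
  obtain d2 where d2: "d2 > 0" "\<forall>k\<in>C0 T. norm_C T k < d2 \<longrightarrow> \<bar>G (\<lambda>t. u t + k t) - G u - M k\<bar> \<le> e * norm_C T k"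
    using M e unfolding has_frechet_deriv_C_def by blast
  define c where "c = min d1 d2 / (2 * (n + 1))"
  have c: "c > 0" using d1 d2 n by (simp add: c_def)
  define k where "k t = c *\<^sub>R h t" for t
  have kC: "k \<in> C0 T" using h by (auto simp: k_def C0_def intro!: continuous_intros)
  have kn: "norm_C T k \<le> c * n"
    using norm_C_scale_le[OF h T, of c] c by (simp add: k_def[abs_def] n_def)
  have "c * n \<le> c * (n + 1)" using c by simp
  also have "\<dots> = min d1 d2 / 2" using n by (simp add: c_def field_simps)
  also have "\<dots> < min d1 d2" using d1(1) d2(1) by (auto simp: min_def)
  finally have "norm_C T k < d1" "norm_C T k < d2" using kn by auto
  then have "\<bar>G (\<lambda>t. u t + k t) - G u - L k\<bar> \<le> e * norm_C T k" "\<bar>G (\<lambda>t. u t + k t) - G u - M k\<bar> \<le> e * norm_C T k"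
    using d1(2) d2(2) kC by blast+
  then have "\<bar>L k - M k\<bar> \<le> 2 * (e * norm_C T k)" by linarith
  also have "\<dots> \<le> 2 * (e * (c * n))" using kn e by simp
  finally have "\<bar>L k - M k\<bar> \<le> c * (2 * e * n)" by (simp add: ac_simps)
  moreover have "L k = c * L h" "M k = c * M h"
    using L M h unfolding has_frechet_deriv_C_def k_def by auto
  then have "\<bar>L k - M k\<bar> = c * D"
    using c by (simp add: D_def abs_mult right_diff_distrib[symmetric])
  ultimately have "D \<le> 2 * e * n" using c by simp
  also have "\<dots> \<le> 2 * e * (n + 1)" using e by simp
  also have "\<dots> = D / 2" using n by (simp add: e_def field_simps)
  finally show False using D by simp
qed

text \<open>The mean value theorem turns the pointwise remainder into a difference of gradients on
  the segment from \<open>u t\<close> to \<open>u t + k t\<close>. Uniform continuity of g on a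
  compact set containing all these segments makes it small uniformly in t.\<close>

lemma F_fun_has_frechet_deriv_C:
  fixes F :: "real \<Rightarrow> 'a::euclidean_space \<Rightarrow> real"
  assumes T: "T > 0"
    and Fc: "continuous_on ({0..T} \<times> UNIV) (\<lambda>(t, x). F t x)"
    and Fg: "\<And>t x. t \<in> {0..T} \<Longrightarrow> GDERIV (F t) x :> g t x"
    and gc: "continuous_on ({0..T} \<times> UNIV) (\<lambda>(t, x). g t x)"
    and u: "u \<in> C0 T"
  shows "has_frechet_deriv_C T (F_fun T F) u (\<lambda>k. - (LINT t|lebesgue_on {0..T}. g t (u t) \<bullet> k t))"
proof -
  let ?M = "lebesgue_on {0..T}"
  have uc: "continuous_on {0..T} u" using u by (simp add: C0_def)
  have comp: "continuous_on {0..T} (\<lambda>t. F t (v t))" if "continuous_on {0..T} v" for v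
  proof -
    have "continuous_on {0..T} (\<lambda>t. case (t, v t) of (t, x) \<Rightarrow> F t x)"
      by (rule continuous_on_compose2[OF Fc]) (auto intro!: continuous_intros that)
    then show ?thesis by simp
  qed
  have hc: "continuous_on {0..T} (\<lambda>t. g t (u t))"
  proof -
    have "continuous_on {0..T} (\<lambda>t. case (t, u t) of (t, x) \<Rightarrow> g t x)"
      by (rule continuous_on_compose2[OF gc]) (auto intro!: continuous_intros uc)
    then show ?thesis by simp
  qed
  have ki: "integrable ?M (\<lambda>t. g t (u t) \<bullet> k t)" if "k \<in> C0 T" for k
    using that by (intro integrable_continuous_ivl continuous_intros hc) (simp add: C0_def)
  obtain B where B: "\<And>t. t \<in> {0..T} \<Longrightarrow> norm (g t (u t)) \<le> B"
    using compact_imp_bounded[OF compact_continuous_image[OF hc]] unfolding bounded_iff by blast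
  have bnd: "\<bar>- (LINT t|?M. g t (u t) \<bullet> k t)\<bar> \<le> (B * T) * norm_C T k" if k: "k \<in> C0 T" for k
  proof -
    have "norm (LINT t|?M. g t (u t) \<bullet> k t) \<le> (B * norm_C T k) * (T - 0)"
    proof (rule lebesgue_integral_bound_ivl)
      show "continuous_on {0..T} (\<lambda>t. g t (u t) \<bullet> k t)"
        using k by (intro continuous_intros hc) (simp add: C0_def)
      fix t assume t: "t \<in> {0..T}"
      have "0 \<le> B" using B[OF t] norm_ge_zero order_trans by blast
      then show "norm (g t (u t) \<bullet> k t) \<le> B * norm_C T k"
        using B[OF t] norm_le_norm_C[OF k t] unfolding real_norm_def
        by (intro order_trans[OF Cauchy_Schwarz_ineq2] mult_mono) auto
    qed (use T in simp)
    then show ?thesis by (simp add: ac_simps)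
  qed
  have small: "\<exists>\<delta>>0. \<forall>k\<in>C0 T. norm_C T k < \<delta> \<longrightarrow>
      \<bar>F_fun T F (\<lambda>t. u t + k t) - F_fun T F u - - (LINT t|?M. g t (u t) \<bullet> k t)\<bar> \<le> e * norm_C T k"
    if e: "e > 0" for e
  proof -
    obtain R where R: "\<And>t. t \<in> {0..T} \<Longrightarrow> norm (u t) \<le> R"
      using compact_imp_bounded[OF compact_continuous_image[OF uc]] unfolding bounded_iff by blast
    \<comment> \<open>The extra 1 leaves room for increments of norm below 1, hence
      \<open>min d 1\<close> below. The tolerance \<open>e / T\<close> compensates for the length of
      the interval.\<close>
    let ?K = "{0..T} \<times> cball (0::'a) (R + 1)"
    have "uniformly_continuous_on ?K (\<lambda>(t, x). g t x)"
      by (intro compact_uniformly_continuous continuous_on_subset[OF gc] compact_Times) auto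
    then obtain d where d: "d > 0" "\<And>p q. p \<in> ?K \<Longrightarrow> q \<in> ?K \<Longrightarrow> dist q p < d \<Longrightarrow>
        dist (case q of (t, x) \<Rightarrow> g t x) (case p of (t, x) \<Rightarrow> g t x) < e / T"
      unfolding uniformly_continuous_on_def using e T by (metis divide_pos_pos)
    show ?thesis
    proof (intro exI[of _ "min d 1"] conjI ballI impI)
      show "min d 1 > 0" using d by simp
      fix k :: "real \<Rightarrow> 'a" assume k: "k \<in> C0 T" and kd: "norm_C T k < min d 1"
      have kc: "continuous_on {0..T} k" using k by (simp add: C0_def)
      let ?r = "\<lambda>t. F t (u t + k t) - F t (u t) - g t (u t) \<bullet> k t"
      have ptw: "norm (?r t) \<le> (e / T) * norm_C T k" if t: "t \<in> {0..T}" for t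
      proof -
        have kt: "norm (k t) \<le> norm_C T k" by (rule norm_le_norm_C[OF k t])
        have "\<exists>r. 0 < r \<and> r < 1 \<and> F t (u t + 1 *\<^sub>R k t) - F t (u t + 0 *\<^sub>R k t) = (1 - 0) * (g t (u t + r *\<^sub>R k t) \<bullet> k t)"
          by (intro MVT2[where f="\<lambda>r. F t (u t + r *\<^sub>R k t)"] DERIV_along_line Fg[OF t]) auto
        then obtain r where r: "0 < r" "r < 1" "F t (u t + k t) - F t (u t) = g t (u t + r *\<^sub>R k t) \<bullet> k t"
          by auto
        have "r * norm (k t) \<le> norm (k t)" using r by (simp add: mult_left_le_one_le)
        then have rk: "norm (r *\<^sub>R k t) < d" "norm (r *\<^sub>R k t) < 1" using r kt kd by auto
        have "dist (g t (u t + r *\<^sub>R k t)) (g t (u t)) < e / T"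
        proof -
          have "u t \<in> cball 0 (R + 1)" "u t + r *\<^sub>R k t \<in> cball 0 (R + 1)"
            using R[OF t] rk(2) norm_triangle_ineq[of "u t" "r *\<^sub>R k t"]
            unfolding mem_cball_0 by linarith+
          then show ?thesis
            using d(2)[of "(t, u t)" "(t, u t + r *\<^sub>R k t)"] rk(1) t
            by (simp add: dist_Pair_Pair dist_norm)
        qed
        then have "norm (g t (u t + r *\<^sub>R k t) - g t (u t)) \<le> e / T" by (simp add: dist_norm)
        moreover have "?r t = (g t (u t + r *\<^sub>R k t) - g t (u t)) \<bullet> k t"
          using r(3) by (simp add: inner_diff_left)
        ultimately show ?thesis
          using mult_mono[of _ "e / T" _ "norm_C T k"] kt e T
          by (auto simp del: times_divide_eq_left intro!: order_trans[OF Cauchy_Schwarz_ineq2])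
      qed
      have i: "integrable ?M (\<lambda>t. F t (u t + k t))" "integrable ?M (\<lambda>t. F t (u t))"
        by (intro integrable_continuous_ivl comp continuous_intros uc kc)+
      have "F_fun T F (\<lambda>t. u t + k t) - F_fun T F u - - (LINT t|?M. g t (u t) \<bullet> k t) = - (LINT t|?M. ?r t)"
        using i ki[OF k] by (simp add: F_fun_def)
      moreover have "norm (LINT t|?M. ?r t) \<le> ((e / T) * norm_C T k) * (T - 0)"
        by (rule lebesgue_integral_bound_ivl) (use T ptw in \<open>auto intro!: continuous_intros comp uc kc hc\<close>)
      ultimately show "\<bar>F_fun T F (\<lambda>t. u t + k t) - F_fun T F u - - (LINT t|?M. g t (u t) \<bullet> k t)\<bar> \<le> e * norm_C T k"
        using T by simp
    qed
  qed
  show ?thesis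
    unfolding has_frechet_deriv_C_def
    using ki bnd small by (auto simp: inner_add_right)
qed

lemma frechet_deriv_C_F_fun:
  fixes F :: "real \<Rightarrow> 'a::euclidean_space \<Rightarrow> real"
  assumes T: "T > 0"
    and Fc: "continuous_on ({0..T} \<times> UNIV) (\<lambda>(t, x). F t x)"
    and Fg: "\<And>t x. t \<in> {0..T} \<Longrightarrow> GDERIV (F t) x :> g t x"
    and gc: "continuous_on ({0..T} \<times> UNIV) (\<lambda>(t, x). g t x)"
    and u: "u \<in> C0 T" and k: "k \<in> C0 T"
  shows "frechet_deriv_C T (F_fun T F) u k = - (LINT t|lebesgue_on {0..T}. g t (u t) \<bullet> k t)"
proof -
  have d: "has_frechet_deriv_C T (F_fun T F) u (\<lambda>k. - (LINT t|lebesgue_on {0..T}. g t (u t) \<bullet> k t))"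
    by (rule F_fun_has_frechet_deriv_C[OF T Fc _ gc u]) (rule Fg)
  then have "has_frechet_deriv_C T (F_fun T F) u (frechet_deriv_C T (F_fun T F) u)"
    unfolding frechet_deriv_C_def
    by (rule someI[where P="has_frechet_deriv_C T (F_fun T F) u"])
  from has_frechet_deriv_C_unique[OF T this d k] show ?thesis .
qed

lemma borel_measurable_continuous_on_comp:
  fixes f :: "'b::topological_space \<Rightarrow> 'c::topological_space"
  assumes "continuous_on A f" "g \<in> borel_measurable M" "\<And>x. x \<in> space M \<Longrightarrow> g x \<in> A"
  shows "(\<lambda>x. f (g x)) \<in> borel_measurable M"
  by (rule measurable_compose[OF measurable_restrict_space2 borel_measurable_continuous_on_restrict])
     (use assms in auto)

section \<open>The singular potential\<close>

text \<open>The inverse is a parameter because the continuous representative of the derivative will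
  be written with it.\<close>

locale convex_potential =
  fixes a :: real and \<phi> \<psi> :: "'a::euclidean_space \<Rightarrow> 'a" and \<Phi> :: "'a \<Rightarrow> real"
  assumes a: "a > 0"
    and homeo: "homeomorphism (ball 0 a) UNIV \<phi> \<psi>"
    and phi_0: "\<phi> 0 = 0"
    and grad: "\<And>x. x \<in> ball 0 a \<Longrightarrow> GDERIV \<Phi> x :> \<phi> x"
    and cont: "continuous_on (cball 0 a) \<Phi>"
    and convex: "convex_on (cball 0 a) \<Phi>"
begin

lemma phi_cont: "continuous_on (ball 0 a) \<phi>"
  using homeo by (simp add: homeomorphism_def)

lemma psi_cont: "continuous_on UNIV \<psi>"
  using homeo by (simp add: homeomorphism_def)

lemma psi_phi: "norm x < a \<Longrightarrow> \<psi> (\<phi> x) = x" and phi_psi: "\<phi> (\<psi> y) = y"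
  using homeo by (auto simp: homeomorphism_def)

lemma psi_less: "norm (\<psi> y) < a"
  using homeomorphism_image2[OF homeo] by (metis mem_ball_0 rangeI)

text \<open>By convexity the difference quotients along the segment from x stay below
  \<open>\<Phi> y - \<Phi> x\<close>. Differentiability enters only at x, so y may lie on the
  sphere.\<close>

lemma gradient_inequality:
  assumes x: "norm x < a" and y: "norm y \<le> a"
  shows "\<Phi> x + \<phi> x \<bullet> (y - x) \<le> \<Phi> y"
proof -
  let ?g = "\<lambda>s. \<Phi> (x + s *\<^sub>R (y - x))"
  have "(?g has_real_derivative \<phi> x \<bullet> (y - x)) (at 0)"
    by (rule DERIV_along_line) (use grad x in simp)
  then have "((\<lambda>s. (?g (0 + s) - ?g 0) / s) \<longlongrightarrow> \<phi> x \<bullet> (y - x)) (at_right 0)"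
    unfolding DERIV_def by (rule tendsto_within_subset) auto
  moreover have "\<forall>\<^sub>F s in at_right 0. (?g (0 + s) - ?g 0) / s \<le> \<Phi> y - \<Phi> x"
    unfolding eventually_at_right_field
  proof (intro exI[of _ 1] conjI allI impI)
    fix s :: real assume s: "0 < s" "s < 1"
    have "\<Phi> ((1 - s) *\<^sub>R x + s *\<^sub>R y) \<le> (1 - s) * \<Phi> x + s * \<Phi> y"
      using convex_onD[OF convex, of s x y] s x y by auto
    moreover have "(1 - s) *\<^sub>R x + s *\<^sub>R y = x + s *\<^sub>R (y - x)" by (simp add: algebra_simps)
    ultimately show "(?g (0 + s) - ?g 0) / s \<le> \<Phi> y - \<Phi> x"
      using s by (simp add: field_simps)
  qed simp
  ultimately have "\<phi> x \<bullet> (y - x) \<le> \<Phi> y - \<Phi> x"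
    by (intro tendsto_upperbound) auto
  then show ?thesis by simp
qed

text \<open>The gradient inequality is used from x to 0 and from 0 to x; the second says that 0
  minimises \<open>\<Phi>\<close>.\<close>

lemma phi_radial_nonneg: "norm x < a \<Longrightarrow> 0 \<le> \<phi> x \<bullet> x"
  using gradient_inequality[of x 0] gradient_inequality[of 0 x] a phi_0 by simp

lemma phi_coercive:
  obtains C where "\<And>x. norm x < a \<Longrightarrow> a / 2 * norm (\<phi> x) - C \<le> \<phi> x \<bullet> x"
proof -
  obtain M where "\<And>x. x \<in> cball 0 a \<Longrightarrow> norm (\<Phi> x) \<le> M"
    using compact_imp_bounded[OF compact_continuous_image[OF cont compact_cball]]
    unfolding bounded_iff by blast
  then have M: "\<bar>\<Phi> x\<bar> \<le> M" if "norm x \<le> a" for x using that by simp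
  have "a / 2 * norm (\<phi> x) - 2 * M \<le> \<phi> x \<bullet> x" if x: "norm x < a" for x
  proof -
    \<comment> \<open>A comparison point in the direction of \<open>\<phi> x\<close> turns the
      gradient inequality into a bound on the norm of \<open>\<phi> x\<close>. Since
      \<open>sgn 0 = 0\<close>, the case \<open>\<phi> x = 0\<close> is covered.\<close>
    define y where "y = (a / 2) *\<^sub>R sgn (\<phi> x)"
    have ny: "norm y \<le> a" using a by (simp add: y_def norm_sgn)
    have "\<phi> x \<bullet> y = a / 2 * norm (\<phi> x)"
      by (cases "\<phi> x = 0") (simp_all add: y_def sgn_div_norm dot_square_norm power2_eq_square)
    then show ?thesis
      using gradient_inequality[OF x ny] M[OF ny] M[of x] x by (simp add: inner_diff_right abs_le_iff)
  qed
  then show ?thesis by (rule that)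
qed

text \<open>The inverse maps the closed ball of radius R onto a compact subset of the open ball, and
  the largest norm in that subset can serve as r.\<close>

lemma phi_blowup:
  obtains r where "0 \<le> r" "r < a" "\<And>x. r < norm x \<Longrightarrow> norm x < a \<Longrightarrow> R < norm (\<phi> x)"
proof -
  \<comment> \<open>Inserting 0 keeps the set non-empty when R is negative.\<close>
  let ?K = "insert 0 (\<psi> ` cball 0 R)"
  have "compact ?K"
    by (intro compact_insert compact_continuous_image continuous_on_subset[OF psi_cont]) auto
  then have "\<exists>x0\<in>?K. \<forall>x\<in>?K. norm x \<le> norm x0"
    by (intro continuous_attains_sup continuous_intros) simp_all
  then obtain x0 where x0: "x0 \<in> ?K" "\<And>x. x \<in> ?K \<Longrightarrow> norm x \<le> norm x0"
    by blast
  show thesis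
  proof (rule that[of "norm x0"])
    show "norm x0 < a" using x0(1) psi_less a by auto
    show "R < norm (\<phi> x)" if "norm x0 < norm x" "norm x < a" for x
    proof (rule ccontr)
      assume "\<not> R < norm (\<phi> x)"
      then have "\<psi> (\<phi> x) \<in> ?K" by auto
      then show False using x0(2)[of x] psi_phi[of x] that by simp
    qed
  qed simp
qed

end

section \<open>The reduced variational inequality\<close>

text \<open>The function \<open>w\<close> stands for the derivative of the critical point, \<open>x0\<close> and
  \<open>x0 + integral {0..T} w\<close> for its boundary values, \<open>h\<close> for \<open>\<nabla>\<^sub>uF(t, u)\<close> and \<open>J0\<close> for \<open>j\<close> at
  the boundary values.\<close>

locale reduced_problem = convex_potential +
  fixes T :: real and h w :: "real \<Rightarrow> 'a::euclidean_space" and j :: "'a \<times> 'a \<Rightarrow> ereal"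
    and x0 y0 :: 'a and J0 :: real
  assumes T: "T > 0"
    and w_meas: "w \<in> borel_measurable (lebesgue_on {0..T})"
    and w_bound: "\<And>t. norm (w t) \<le> a"
    and h_cont: "continuous_on {0..T} h"
    and J0: "j (x0, y0) = ereal J0"
    and variational: "\<And>x q J1. q \<in> borel_measurable (lebesgue_on {0..T}) \<Longrightarrow> (\<And>t. norm (q t) \<le> a) \<Longrightarrow>
      j (x, x + integral {0..T} q) \<le> ereal J1 \<Longrightarrow>
      0 \<le> (LINT t|lebesgue_on {0..T}. \<Phi> (q t) - \<Phi> (w t)) + (J1 - J0)
        - (LINT t|lebesgue_on {0..T}. h t \<bullet> (x - x0 + integral {0..t} (\<lambda>r. q r - w r)))"
    and y0: "y0 = x0 + integral {0..T} w"
begin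

abbreviation M :: "real measure" where "M \<equiv> lebesgue_on {0..T}"

definition H :: "real \<Rightarrow> 'a" where "H t = integral {0..t} h"

text \<open>The force term after integration by parts. Here z is multiplied pointwise by
  \<open>H\<close>, so this can be compared directly with the integral of
  \<open>\<phi> (w t) \<bullet> z t\<close>.\<close>

definition load :: "'a \<Rightarrow> (real \<Rightarrow> 'a) \<Rightarrow> real" where
  "load \<xi> z = H T \<bullet> (\<xi> + integral {0..T} z) - (LINT t|M. H t \<bullet> z t)"

lemma h_bounded: obtains B where "\<And>t. t \<in> {0..T} \<Longrightarrow> norm (h t) \<le> B"
  using compact_imp_bounded[OF compact_continuous_image[OF h_cont]] unfolding bounded_iff by blast

lemma h_meas: "h \<in> borel_measurable M"
  by (rule continuous_imp_measurable_on_sets_lebesgue[OF h_cont]) simp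

lemma H_cont: "continuous_on {0..T} H"
  unfolding H_def by (rule continuous_on_primitive[OF integrable_continuous_ivl[OF h_cont]])

lemma H_meas: "H \<in> borel_measurable M"
  by (rule continuous_imp_measurable_on_sets_lebesgue[OF H_cont]) simp

lemma H_bounded: obtains B where "\<And>t. t \<in> {0..T} \<Longrightarrow> norm (H t) \<le> B"
  using compact_imp_bounded[OF compact_continuous_image[OF H_cont]] unfolding bounded_iff by blast

lemma load_eq:
  assumes z: "z \<in> borel_measurable M" "\<And>t. t \<in> {0..T} \<Longrightarrow> norm (z t) \<le> B"
  shows "(LINT t|M. h t \<bullet> (\<xi> + integral {0..t} z)) = load \<xi> z"
proof -
  obtain C where C: "\<And>t. t \<in> {0..T} \<Longrightarrow> norm (h t) \<le> C" using h_bounded by blast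
  have Zc: "continuous_on {0..T} (\<lambda>t. integral {0..t} z)"
    by (rule continuous_on_primitive[OF integrable_bounded_ivl[OF z]])
  have hi: "integrable M h" by (rule integrable_continuous_ivl[OF h_cont])
  have i: "integrable M (\<lambda>t. h t \<bullet> \<xi>)" "integrable M (\<lambda>t. h t \<bullet> integral {0..t} z)"
    by (intro integrable_continuous_ivl continuous_intros h_cont Zc)+
  have "(LINT t|M. h t \<bullet> (\<xi> + integral {0..t} z)) = (LINT t|M. h t \<bullet> \<xi>) + (LINT t|M. h t \<bullet> integral {0..t} z)"
    using i by (simp add: inner_add_right)
  also have "(LINT t|M. h t \<bullet> \<xi>) = H T \<bullet> \<xi>"
    using hi lebesgue_integral_eq_integral[OF hi] by (simp add: H_def)
  also have "(LINT t|M. h t \<bullet> integral {0..t} z) = H T \<bullet> integral {0..T} z - (LINT t|M. H t \<bullet> z t)"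
    using integral_by_parts_primitives[OF _ h_meas C z] T by (simp add: H_def)
  finally show ?thesis by (simp add: load_def inner_add_right)
qed

lemma Phi_comp_integrable:
  assumes "q \<in> borel_measurable M" "\<And>t. norm (q t) \<le> a"
  shows "integrable M (\<lambda>t. \<Phi> (q t))"
proof -
  obtain C where C: "\<And>x. x \<in> cball 0 a \<Longrightarrow> norm (\<Phi> x) \<le> C"
    using compact_imp_bounded[OF compact_continuous_image[OF cont compact_cball]]
    unfolding bounded_iff by blast
  show ?thesis
    by (rule integrable_bounded_ivl[OF borel_measurable_continuous_on_comp[OF cont assms(1)], where B=C])
       (use assms(2) C in auto)
qed

lemma phi_comp_measurable:
  assumes "q \<in> borel_measurable M" "\<And>t. norm (q t) < a"
  shows "(\<lambda>t. \<phi> (q t)) \<in> borel_measurable M"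
  by (rule borel_measurable_continuous_on_comp[OF phi_cont assms(1)]) (use assms(2) in auto)

text \<open>The convexity bound \<open>\<Phi>(w + sz) - \<Phi>(w) \<le> s \<langle>\<phi>(w + sz)|z\<rangle>\<close> avoids differentiating \<open>\<Phi>\<close> on the
  boundary sphere.\<close>

lemma variational_gradient:
  assumes z: "z \<in> borel_measurable M" "\<And>t. norm (z t) \<le> B" and s: "0 < s"
    and p: "p \<in> borel_measurable M" "\<And>t. norm (p t) \<le> r" and r: "r < a"
    and pz: "\<And>t. p t = w t + s *\<^sub>R z t \<or> z t = 0"
    and J: "j (x0 + s *\<^sub>R \<xi>, y0 + s *\<^sub>R (\<xi> + integral {0..T} z)) \<le> ereal (J0 + s * d)"
  shows "0 \<le> (LINT t|M. \<phi> (p t) \<bullet> z t) + d - load \<xi> z"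
proof -
  let ?q = "\<lambda>t. w t + s *\<^sub>R z t"
  have wi: "integrable M w" by (rule integrable_bounded_ivl[OF w_meas w_bound])
  have zi: "integrable M z" by (rule integrable_bounded_ivl[OF z])
  have wo: "w integrable_on {0..T}" and zo: "z integrable_on {0..T}"
    by (rule integrable_on_lebesgue_on[OF wi], simp, rule integrable_on_lebesgue_on[OF zi], simp)
  have qm: "?q \<in> borel_measurable M" using w_meas z(1) by measurable
  \<comment> \<open>The bound r controls \<open>?q\<close> only where z is nonzero; elsewhere
    \<open>?q\<close> equals w, which may still touch the sphere.\<close>
  have qb: "norm (?q t) \<le> a" for t
    using pz[of t] p(2)[of t] r w_bound[of t] by (cases "z t = 0") auto
  have qint: "integral {0..T} ?q = integral {0..T} w + s *\<^sub>R integral {0..T} z"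
    using wo zo by (simp add: integral_add integrable_cmul)
  have pm: "(\<lambda>t. \<phi> (p t)) \<in> borel_measurable M"
    using p(2) r by (intro phi_comp_measurable p) (metis order.strict_trans1)
  have pin: "integrable M (\<lambda>t. \<phi> (p t) \<bullet> z t)"
  proof -
    have sub: "cball 0 r \<subseteq> ball (0::'a) a" using r by auto
    obtain C where C: "\<And>x. x \<in> cball 0 r \<Longrightarrow> norm (\<phi> x) \<le> C"
      using compact_imp_bounded[OF compact_continuous_image[OF continuous_on_subset[OF phi_cont sub] compact_cball]]
      unfolding bounded_iff by blast
    show ?thesis
    proof (rule integrable_bounded_ivl)
      show "(\<lambda>t. \<phi> (p t) \<bullet> z t) \<in> borel_measurable M" using pm z(1) by measurable
      fix t
      have "norm (\<phi> (p t)) \<le> C" using C p(2) by simp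
      moreover have "0 \<le> C" using calculation norm_ge_zero order_trans by blast
      ultimately show "norm (\<phi> (p t) \<bullet> z t) \<le> C * B"
        using z(2)[of t] unfolding real_norm_def
        by (intro order_trans[OF Cauchy_Schwarz_ineq2] mult_mono) auto
    qed
  qed
  have "0 \<le> (LINT t|M. \<Phi> (?q t) - \<Phi> (w t)) + (J0 + s * d - J0)
      - (LINT t|M. h t \<bullet> (x0 + s *\<^sub>R \<xi> - x0 + integral {0..t} (\<lambda>r. ?q r - w r)))"
  proof (rule variational[OF qm qb])
    have "x0 + s *\<^sub>R \<xi> + integral {0..T} ?q = y0 + s *\<^sub>R (\<xi> + integral {0..T} z)"
      by (simp add: qint y0 algebra_simps)
    then show "j (x0 + s *\<^sub>R \<xi>, x0 + s *\<^sub>R \<xi> + integral {0..T} ?q) \<le> ereal (J0 + s * d)"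
      using J by simp
  qed
  also have "(LINT t|M. h t \<bullet> (x0 + s *\<^sub>R \<xi> - x0 + integral {0..t} (\<lambda>r. ?q r - w r))) =
      (LINT t|M. s * (h t \<bullet> (\<xi> + integral {0..t} z)))"
    by (intro Bochner_Integration.integral_cong) (auto simp: inner_add_right algebra_simps)
  also have "\<dots> = s * load \<xi> z" using load_eq[OF z] by simp
  finally have "0 \<le> (LINT t|M. \<Phi> (?q t) - \<Phi> (w t)) + s * d - s * load \<xi> z" by simp
  moreover have "(LINT t|M. \<Phi> (?q t) - \<Phi> (w t)) \<le> (LINT t|M. s * (\<phi> (p t) \<bullet> z t))"
  proof (rule integral_mono)
    show "integrable M (\<lambda>t. \<Phi> (?q t) - \<Phi> (w t))"
      by (intro Bochner_Integration.integrable_diff Phi_comp_integrable qm qb w_meas w_bound)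
    show "integrable M (\<lambda>t. s * (\<phi> (p t) \<bullet> z t))" using pin by simp
    fix t
    show "\<Phi> (?q t) - \<Phi> (w t) \<le> s * (\<phi> (p t) \<bullet> z t)"
    proof (cases "z t = 0")
      case False
      then have pt: "p t = ?q t" using pz by blast
      then have "norm (?q t) < a" using p(2)[of t] r by simp
      from gradient_inequality[OF this w_bound[of t]]
      show ?thesis by (simp add: pt)
    qed simp
  qed
  ultimately have "0 \<le> s * ((LINT t|M. \<phi> (p t) \<bullet> z t) + d - load \<xi> z)"
    by (simp add: algebra_simps)
  then show ?thesis using s by (simp add: zero_le_mult_iff)
qed

text \<open>On the set where the norm of w equals \<open>a\<close>, blow-up and coercivity make the
  integrand at least \<open>a / 2 * R - C\<close> for s small, with R arbitrary; it is non-negative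
  elsewhere. A fixed bound D then forces the set to be null.\<close>

lemma derivative_interior:
  assumes j0: "j (0, 0) = 0" and j_nonneg: "\<And>x. 0 \<le> j x" and j_convex: "ereal_convex j"
  shows "AE t in M. norm (w t) < a"
proof -
  define D where "D = - J0 - load (- x0) (\<lambda>t. - w t)"
  have J0n: "0 \<le> J0" using j_nonneg[of "(x0, y0)"] J0 by simp
  \<comment> \<open>Shrinking is the variation with \<open>z = - w\<close> and
    \<open>\<xi> = - x0\<close>. Convexity and \<open>j (0, 0) = 0\<close> give the boundary term
    slope \<open>- J0\<close>, and D does not depend on s.\<close>
  have key: "(LINT t|M. \<phi> ((1 - s) *\<^sub>R w t) \<bullet> w t) \<le> D" if s: "0 < s" "s < 1" for s
  proof -
    have "0 \<le> (LINT t|M. \<phi> ((1 - s) *\<^sub>R w t) \<bullet> (- w t)) + (- J0) - load (- x0) (\<lambda>t. - w t)"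
    proof (rule variational_gradient[where s=s and B=a and r="(1 - s) * a"])
      show "(1 - s) * a < a" using s a by (simp add: left_diff_distrib)
      show "norm ((1 - s) *\<^sub>R w t) \<le> (1 - s) * a" for t
        using s w_bound[of t] by (simp add: mult_left_mono)
      have "j ((1 - s) *\<^sub>R (x0, y0) + s *\<^sub>R (0, 0)) \<le> ereal (1 - s) * j (x0, y0) + ereal s * j (0, 0)"
        using j_convex s unfolding ereal_convex_def by blast
      then have "j ((1 - s) *\<^sub>R x0, (1 - s) *\<^sub>R y0) \<le> ereal (J0 + s * - J0)"
        by (simp add: J0 j0 algebra_simps)
      moreover have "(1 - s) *\<^sub>R x0 = x0 + s *\<^sub>R - x0"
        "(1 - s) *\<^sub>R y0 = y0 + s *\<^sub>R (- x0 + integral {0..T} (\<lambda>t. - w t))"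
        by (simp_all add: y0 algebra_simps)
      ultimately show "j (x0 + s *\<^sub>R - x0, y0 + s *\<^sub>R (- x0 + integral {0..T} (\<lambda>t. - w t))) \<le> ereal (J0 + s * - J0)"
        by simp
    qed (use s w_meas w_bound in \<open>auto simp: algebra_simps\<close>)
    then show ?thesis by (simp add: D_def)
  qed
  obtain C where C: "\<And>x. norm x < a \<Longrightarrow> a / 2 * norm (\<phi> x) - C \<le> \<phi> x \<bullet> x"
    using phi_coercive by blast
  let ?A = "{t \<in> space M. norm (w t) = a}"
  have A: "?A \<in> sets M" using w_meas by measurable
  have fin: "emeasure M ?A < \<infinity>"
  proof -
    interpret finite_measure M by (rule finite_measure_lebesgue_on) simp
    show ?thesis by (simp add: less_top[symmetric])
  qed
  have bound: "measure M ?A * (a / 2 * R - C) \<le> D" for R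
  proof -
    obtain r where r: "0 \<le> r" "r < a" "\<And>x. r < norm x \<Longrightarrow> norm x < a \<Longrightarrow> R < norm (\<phi> x)"
      using phi_blowup[of R] by blast
    \<comment> \<open>This makes \<open>(1 - s) * a\<close> the midpoint of r and \<open>a\<close>:
      still in the ball, but beyond the blow-up radius.\<close>
    define s where "s = (a - r) / (2 * a)"
    have s: "0 < s" "s < 1" "(1 - s) * a > r"
      using r a by (auto simp: s_def field_simps)
    have wm: "(\<lambda>t. (1 - s) *\<^sub>R w t) \<in> borel_measurable M" using w_meas by measurable
    have wl: "norm ((1 - s) *\<^sub>R w t) < a" for t
    proof -
      have "(1 - s) * norm (w t) \<le> (1 - s) * a" using s w_bound[of t] by simp
      also have "\<dots> < a" using s a by (simp add: left_diff_distrib)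
      finally show ?thesis using s by simp
    qed
    let ?f = "\<lambda>t. \<phi> ((1 - s) *\<^sub>R w t) \<bullet> w t"
    have fp: "\<phi> ((1 - s) *\<^sub>R w t) \<bullet> ((1 - s) *\<^sub>R w t) \<le> ?f t" "0 \<le> ?f t" for t
    proof -
      have "0 \<le> (1 - s) * ?f t" using phi_radial_nonneg[OF wl[of t]] by simp
      then show f0: "0 \<le> ?f t" using s by (simp add: zero_le_mult_iff)
      then have "(1 - s) * ?f t \<le> ?f t" using s by (intro mult_left_le_one_le) auto
      then show "\<phi> ((1 - s) *\<^sub>R w t) \<bullet> ((1 - s) *\<^sub>R w t) \<le> ?f t" by simp
    qed
    have fi: "integrable M ?f"
    proof -
      have sub: "cball 0 ((1 - s) * a) \<subseteq> ball (0::'a) a" using mult_pos_pos[OF s(1) a] by (auto simp: left_diff_distrib)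
      obtain E where E: "\<And>x. x \<in> cball 0 ((1 - s) * a) \<Longrightarrow> norm (\<phi> x) \<le> E"
        using compact_imp_bounded[OF compact_continuous_image[OF continuous_on_subset[OF phi_cont sub] compact_cball]]
        unfolding bounded_iff by blast
      show ?thesis
      proof (rule integrable_bounded_ivl)
        show "?f \<in> borel_measurable M" using phi_comp_measurable[OF wm wl] w_meas by measurable
        fix t
        have "norm (\<phi> ((1 - s) *\<^sub>R w t)) \<le> E" using E[of "(1 - s) *\<^sub>R w t"] s w_bound[of t] by simp
        moreover have "0 \<le> E" using calculation norm_ge_zero order_trans by blast
        ultimately show "norm (?f t) \<le> E * a"
          using w_bound[of t] unfolding real_norm_def
          by (intro order_trans[OF Cauchy_Schwarz_ineq2] mult_mono) auto
      qed
    qed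
    have "(LINT t|M. indicator ?A t * (a / 2 * R - C)) \<le> (LINT t|M. ?f t)"
    proof (rule integral_mono)
      show "integrable M (\<lambda>t. indicator ?A t * (a / 2 * R - C))" using A fin by simp
      fix t
      show "indicator ?A t * (a / 2 * R - C) \<le> ?f t"
      proof (cases "t \<in> ?A")
        case True
        then have "R < norm (\<phi> ((1 - s) *\<^sub>R w t))"
          using s by (intro r(3) wl) auto
        then have "a / 2 * R \<le> a / 2 * norm (\<phi> ((1 - s) *\<^sub>R w t))"
          using a by (intro mult_left_mono) auto
        then show ?thesis using C[OF wl[of t]] fp(1)[of t] True by simp
      qed (use fp in simp)
    qed (rule fi)
    also have "\<dots> \<le> D" by (rule key[OF s(1,2)])
    also have "(LINT t|M. indicator ?A t * (a / 2 * R - C)) = measure M (?A \<inter> space M) * (a / 2 * R - C)"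
      using A by simp
    also have "?A \<inter> space M = ?A" by blast
    finally show ?thesis .
  qed
  have "measure M ?A = 0"
  proof (rule ccontr)
    assume "measure M ?A \<noteq> 0"
    then have m: "measure M ?A > 0" using measure_nonneg[of M ?A] by linarith
    \<comment> \<open>R is chosen so that the lower bound equals \<open>D + 1\<close>.\<close>
    have "measure M ?A * (a / 2 * (2 / a * (C + (D + 1) / measure M ?A)) - C) = D + 1"
      using a m by (simp add: field_simps)
    then show False using bound[of "2 / a * (C + (D + 1) / measure M ?A)"] by simp
  qed
  then have "emeasure M ?A = 0" using fin emeasure_eq_ennreal_measure[of M ?A] by (simp add: less_top[symmetric])
  then have "AE t in M. \<not> norm (w t) = a" using A by (subst AE_iff_measurable[OF A]) auto
  then show ?thesis by eventually_elim (use w_bound in \<open>auto simp: order.strict_iff_order\<close>)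
qed

text \<open>The limit of \<open>variational_gradient\<close> as s tends to 0. All moved points stay
  in a closed ball of radius below \<open>a\<close>, where \<open>\<phi>\<close> is bounded, so
  dominated convergence applies.\<close>

lemma first_variation:
  assumes z: "z \<in> borel_measurable M" "\<And>t. norm (z t) \<le> B" and r: "r < a" "0 \<le> r"
    and wz: "\<And>t. norm (w t) \<le> r \<or> z t = 0"
    and J: "\<And>s. 0 < s \<Longrightarrow> s < 1 \<Longrightarrow>
      j (x0 + s *\<^sub>R \<xi>, y0 + s *\<^sub>R (\<xi> + integral {0..T} z)) \<le> ereal (J0 + s * d)"
  shows "0 \<le> (LINT t|M. \<phi> (w t) \<bullet> z t) + d - load \<xi> z"
proof -
  have B: "0 \<le> B" using z(2)[of 0] norm_ge_zero order_trans by blast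
  \<comment> \<open>Where z vanishes, w may lie on the sphere, outside the domain of
    \<open>\<phi>\<close>. The value 0 there leaves the integrand unchanged.\<close>
  define w' where "w' t = (if z t = 0 then 0 else w t)" for t
  have w'm: "w' \<in> borel_measurable M"
    unfolding w'_def using z(1) w_meas by measurable
  have w'b: "norm (w' t) \<le> r" for t using wz[of t] r by (auto simp: w'_def)
  define \<rho> where "\<rho> = (r + a) / 2"
  have \<rho>: "r < \<rho>" "\<rho> < a" using r by (auto simp: \<rho>_def)
  \<comment> \<open>The \<open>1/2\<close> keeps s below 1, the quotient keeps the moved points
    within radius \<rho>, and \<open>B + 1\<close> avoids division by zero.\<close>
  define s where "s n = min (1/2) ((\<rho> - r) / (B + 1)) / real (Suc n)" for n
  have s: "0 < s n" "s n < 1" "s n * B \<le> \<rho> - r" for n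
  proof -
    have m: "0 < min (1/2) ((\<rho> - r) / (B + 1))" using \<rho> B by simp
    then show "0 < s n" by (simp add: s_def)
    have le: "s n \<le> min (1/2) ((\<rho> - r) / (B + 1))"
      unfolding s_def using m by (intro divide_left_mono[where b=1, simplified] | simp add: field_simps)+
    then show "s n < 1" by simp
    have "s n * B \<le> ((\<rho> - r) / (B + 1)) * (B + 1)" using le B \<rho> by (intro mult_mono) auto
    then show "s n * B \<le> \<rho> - r" using B by simp
  qed
  have slim: "s \<longlonglongrightarrow> 0"
    unfolding s_def by (rule lim_const_over_n[THEN LIMSEQ_Suc])
  define p where "p n t = w' t + s n *\<^sub>R z t" for n t
  have pm: "p n \<in> borel_measurable M" for n
    unfolding p_def using w'm z(1) by measurable
  have pb: "norm (p n t) \<le> \<rho>" for n t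
  proof -
    have "norm (p n t) \<le> norm (w' t) + s n * norm (z t)"
      unfolding p_def using norm_triangle_ineq[of "w' t" "s n *\<^sub>R z t"] s(1)[of n] by simp
    also have "\<dots> \<le> r + s n * B"
      using w'b[of t] z(2)[of t] s(1)[of n] by (intro add_mono mult_left_mono) auto
    finally show ?thesis using s(3)[of n] by simp
  qed
  have pl: "norm (p n t) < a" for n t using pb[of n t] \<rho> by simp
  have ineq: "0 \<le> (LINT t|M. \<phi> (p n t) \<bullet> z t) + d - load \<xi> z" for n
    by (rule variational_gradient[OF z s(1) pm pb \<rho>(2) _ J[OF s(1,2)]])
       (auto simp: p_def w'_def)
  have sub: "cball 0 \<rho> \<subseteq> ball (0::'a) a" using \<rho> by auto
  obtain C where C: "\<And>x. x \<in> cball 0 \<rho> \<Longrightarrow> norm (\<phi> x) \<le> C"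
    using compact_imp_bounded[OF compact_continuous_image[OF continuous_on_subset[OF phi_cont sub] compact_cball]]
    unfolding bounded_iff by blast
  have "(\<lambda>n. LINT t|M. \<phi> (p n t) \<bullet> z t) \<longlonglongrightarrow> (LINT t|M. \<phi> (w' t) \<bullet> z t)"
  proof (rule integral_dominated_convergence[where w="\<lambda>_. C * B"])
    show "(\<lambda>t. \<phi> (w' t) \<bullet> z t) \<in> borel_measurable M"
    proof -
      have "norm (w' t) < a" for t using w'b[of t] r by simp
      then show ?thesis by (intro borel_measurable_inner phi_comp_measurable w'm z(1))
    qed
    show "(\<lambda>t. \<phi> (p n t) \<bullet> z t) \<in> borel_measurable M" for n
      using phi_comp_measurable[OF pm pl] z(1) by auto
    show "integrable M (\<lambda>_. C * B)" by simp
    show "AE t in M. (\<lambda>n. \<phi> (p n t) \<bullet> z t) \<longlonglongrightarrow> \<phi> (w' t) \<bullet> z t"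
    proof (rule AE_I2)
      fix t
      have "(\<lambda>n. p n t) \<longlonglongrightarrow> w' t + 0 *\<^sub>R z t"
        unfolding p_def by (intro tendsto_intros slim)
      moreover have "isCont \<phi> (w' t)"
        using phi_cont w'b[of t] r by (auto simp: continuous_on_eq_continuous_at)
      ultimately have "(\<lambda>n. \<phi> (p n t)) \<longlonglongrightarrow> \<phi> (w' t)"
        by (intro isCont_tendsto_compose[of _ \<phi>]) auto
      then show "(\<lambda>n. \<phi> (p n t) \<bullet> z t) \<longlonglongrightarrow> \<phi> (w' t) \<bullet> z t"
        by (intro tendsto_intros)
    qed
    show "AE t in M. norm (\<phi> (p n t) \<bullet> z t) \<le> C * B" for n
    proof (rule AE_I2)
      fix t
      have "norm (\<phi> (p n t)) \<le> C" using C pb by simp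
      moreover have "0 \<le> C" using calculation norm_ge_zero order_trans by blast
      ultimately show "norm (\<phi> (p n t) \<bullet> z t) \<le> C * B"
        using z(2)[of t] unfolding real_norm_def
        by (intro order_trans[OF Cauchy_Schwarz_ineq2] mult_mono) auto
    qed
  qed
  then have "(\<lambda>n. (LINT t|M. \<phi> (p n t) \<bullet> z t) + d - load \<xi> z) \<longlonglongrightarrow> (LINT t|M. \<phi> (w' t) \<bullet> z t) + d - load \<xi> z"
    by (intro tendsto_intros)
  then have "0 \<le> (LINT t|M. \<phi> (w' t) \<bullet> z t) + d - load \<xi> z"
    by (rule LIMSEQ_le_const) (use ineq in auto)
  moreover have "(\<lambda>t. \<phi> (w' t) \<bullet> z t) = (\<lambda>t. \<phi> (w t) \<bullet> z t)"
    by (auto simp: w'_def fun_eq_iff)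
  ultimately show ?thesis by simp
qed

text \<open>On \<open>{t. norm (w t) \<le> r}\<close> the variation is minus the deviation of \<open>\<phi>(w) + H\<close> from its mean.\<close>

lemma const_on_sublevel:
  assumes r: "r < a" "0 \<le> r"
  obtains m where "AE t in M. norm (w t) \<le> r \<longrightarrow> \<phi> (w t) + H t = m"
proof -
  define E where "E = {t \<in> space M. norm (w t) \<le> r}"
  have E: "E \<in> sets M" unfolding E_def using w_meas by measurable
  define w' where "w' t = (if norm (w t) \<le> r then w t else 0)" for t
  have w'm: "w' \<in> borel_measurable M" unfolding w'_def using w_meas by measurable
  have w'b: "norm (w' t) \<le> r" for t using r by (simp add: w'_def)
  have sub: "cball 0 r \<subseteq> ball (0::'a) a" using r by auto
  obtain C where C: "\<And>x. x \<in> cball 0 r \<Longrightarrow> norm (\<phi> x) \<le> C"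
    using compact_imp_bounded[OF compact_continuous_image[OF continuous_on_subset[OF phi_cont sub] compact_cball]]
    unfolding bounded_iff by blast
  obtain D where D: "\<And>t. t \<in> {0..T} \<Longrightarrow> norm (H t) \<le> D" using H_bounded by blast
  define G where "G t = indicator E t *\<^sub>R (\<phi> (w' t) + H t)" for t
  have Gm: "G \<in> borel_measurable M"
  proof -
    have "(\<lambda>t. \<phi> (w' t)) \<in> borel_measurable M"
      using w'b r by (intro phi_comp_measurable w'm) (metis order.strict_trans1)
    then show ?thesis unfolding G_def using H_meas E by measurable
  qed
  have Gb: "norm (G t) \<le> C + D" for t
  proof (cases "t \<in> E")
    case True
    then show ?thesis
      using norm_triangle_ineq[of "\<phi> (w' t)" "H t"] C[of "w' t"] w'b[of t] D[of t]
      by (simp add: G_def E_def)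
  next
    case False
    have "0 \<le> C + D" using C[of 0] D[of 0] r T norm_ge_zero[of "\<phi> 0"] norm_ge_zero[of "H 0"]
      by (simp del: norm_ge_zero)
    then show ?thesis using False by (simp add: G_def)
  qed
  have Gi: "integrable M G" by (rule integrable_bounded_ivl[OF Gm Gb])
  have Ei: "integrable M (indicator E :: real \<Rightarrow> real)"
    by (rule integrable_bounded_ivl[where B=1]) (use E in \<open>auto simp: indicator_def\<close>)
  define \<mu> where "\<mu> = (LINT t|M. indicator E t :: real)"
  \<comment> \<open>If E is null, then \<mu> is 0 and m is 0 by the convention for inverses; the
    mean of z is still zero since G vanishes almost everywhere.\<close>
  define m where "m = (LINT t|M. G t) /\<^sub>R \<mu>"
  define z where "z t = indicator E t *\<^sub>R m - G t" for t
  have zm: "z \<in> borel_measurable M" unfolding z_def using Gm E by measurable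
  have zb: "norm (z t) \<le> norm m + (C + D)" for t
  proof -
    have "norm (z t) \<le> norm (indicator E t *\<^sub>R m) + norm (G t)"
      unfolding z_def by (rule norm_triangle_ineq4)
    also have "norm (indicator E t *\<^sub>R m) \<le> norm m" by (simp add: indicator_def)
    finally show ?thesis using Gb[of t] by simp
  qed
  have zi: "integrable M z" by (rule integrable_bounded_ivl[OF zm zb])
  have zz: "z t = 0" if "t \<notin> E" for t using that by (simp add: z_def G_def)
  have LG0: "(LINT t|M. G t) = 0" if "\<mu> = 0"
  proof -
    have "AE t in M. indicator E t = (0::real)"
      using that Ei unfolding \<mu>_def by (subst (asm) integral_nonneg_eq_0_iff_AE) auto
    then have "AE t in M. G t = 0" by eventually_elim (simp add: G_def)
    then show ?thesis by (rule integral_eq_zero_AE)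
  qed
  have "(LINT t|M. z t) = (LINT t|M. indicator E t *\<^sub>R m) - (LINT t|M. G t)"
    unfolding z_def using Ei Gi by (intro Bochner_Integration.integral_diff) auto
  also have "(LINT t|M. indicator E t *\<^sub>R m) = \<mu> *\<^sub>R m"
    unfolding \<mu>_def using Ei by simp
  also have "\<dots> - (LINT t|M. G t) = 0" using LG0 by (cases "\<mu> = 0") (auto simp: m_def)
  finally have Lz: "(LINT t|M. z t) = 0" .
  then have Iz: "integral {0..T} z = 0" using lebesgue_integral_eq_integral[OF zi] by simp
  \<comment> \<open>With mean zero and no shift, the boundary values do not move, so d can be
    0.\<close>
  have "0 \<le> (LINT t|M. \<phi> (w t) \<bullet> z t) + 0 - load 0 z"
    by (rule first_variation[OF zm zb r]) (use zz Iz J0 in \<open>auto simp: E_def\<close>)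
  also have "(LINT t|M. \<phi> (w t) \<bullet> z t) = (LINT t|M. G t \<bullet> z t - H t \<bullet> z t)"
  proof (rule Bochner_Integration.integral_cong)
    show "\<phi> (w t) \<bullet> z t = G t \<bullet> z t - H t \<bullet> z t" for t
      using zz[of t] by (cases "t \<in> E") (auto simp: G_def w'_def E_def inner_add_left)
  qed simp
  also have "\<dots> = (LINT t|M. G t \<bullet> z t) - (LINT t|M. H t \<bullet> z t)"
  proof (rule Bochner_Integration.integral_diff; rule integrable_bounded_ivl)
    show "(\<lambda>t. G t \<bullet> z t) \<in> borel_measurable M" "(\<lambda>t. H t \<bullet> z t) \<in> borel_measurable M"
      using Gm zm H_meas by auto
    show "norm (G t \<bullet> z t) \<le> (C + D) * (norm m + (C + D))" for t
      using Gb[of t] zb[of t] order_trans[OF norm_ge_zero Gb[of t]] unfolding real_norm_def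
      by (intro order_trans[OF Cauchy_Schwarz_ineq2] mult_mono) auto
    show "norm (H t \<bullet> z t) \<le> D * (norm m + (C + D))" if "t \<in> {0..T}" for t
      using D[OF that] zb[of t] order_trans[OF norm_ge_zero D[OF that]] unfolding real_norm_def
      by (intro order_trans[OF Cauchy_Schwarz_ineq2] mult_mono) auto
  qed
  finally have 1: "0 \<le> (LINT t|M. G t \<bullet> z t)" by (simp add: load_def Iz)
  have zzi: "integrable M (\<lambda>t. z t \<bullet> z t)"
  proof (rule integrable_bounded_ivl)
    show "norm (z t \<bullet> z t) \<le> (norm m + (C + D)) * (norm m + (C + D))" for t
      using zb[of t] order_trans[OF norm_ge_zero zb[of t]] unfolding real_norm_def
      by (intro order_trans[OF Cauchy_Schwarz_ineq2] mult_mono) auto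
  qed (use zm in auto)
  \<comment> \<open>On E the function G is \<open>m - z\<close>, and the mean of z is zero. The
    non-negative integral of \<open>G \<bullet> z\<close> is therefore minus the integral of
    \<open>z \<bullet> z\<close>, which must vanish; one sign of the variation is enough.\<close>
  have "(LINT t|M. G t \<bullet> z t) = (LINT t|M. m \<bullet> z t - z t \<bullet> z t)"
  proof (rule Bochner_Integration.integral_cong)
    show "G t \<bullet> z t = m \<bullet> z t - z t \<bullet> z t" for t
      using zz[of t] by (cases "t \<in> E") (auto simp: z_def inner_diff_left inner_diff_right)
  qed simp
  also have "\<dots> = m \<bullet> (LINT t|M. z t) - (LINT t|M. z t \<bullet> z t)"
    using zi zzi by simp
  finally have "(LINT t|M. z t \<bullet> z t) \<le> 0" using 1 Lz by simp
  moreover have "0 \<le> (LINT t|M. z t \<bullet> z t)" by (rule integral_nonneg_AE) simp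
  ultimately have "(LINT t|M. z t \<bullet> z t) = 0" by linarith
  then have "AE t in M. z t \<bullet> z t = 0"
    using zzi by (subst (asm) integral_nonneg_eq_0_iff_AE) auto
  moreover have "AE t in M. t \<in> space M" by (rule AE_space)
  ultimately have "AE t in M. norm (w t) \<le> r \<longrightarrow> \<phi> (w t) + H t = m"
    by eventually_elim (auto simp: z_def G_def w'_def E_def)
  then show thesis by (rule that)
qed

text \<open>The levels r n exhaust the ball, but each comes with its own constant, which is
  arbitrary if the sublevel set is null. Every good point is compared with one fixed good point at a
  level containing both, so a single constant results.\<close>

lemma Euler_Lagrange:
  assumes int: "AE t in M. norm (w t) < a"
  obtains c where "AE t in M. w t = \<psi> (c - H t)"
proof -
  define r where "r n = a - a / real (n + 1)" for n :: nat
  have r: "r n < a" "0 \<le> r n" for n using a by (auto simp: r_def field_simps)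
  have "\<exists>m. AE t in M. norm (w t) \<le> r n \<longrightarrow> \<phi> (w t) + H t = m" for n
    using const_on_sublevel[OF r] by blast
  then obtain m where m: "\<And>n. AE t in M. norm (w t) \<le> r n \<longrightarrow> \<phi> (w t) + H t = m n"
    by metis
  have rlim: "r \<longlonglongrightarrow> a - 0"
    unfolding r_def Suc_eq_plus1[symmetric] by (intro tendsto_intros lim_const_over_n[THEN LIMSEQ_Suc])
  have mono: "r i \<le> r k" if "i \<le> k" for i k
    using that a by (auto simp: r_def intro!: divide_left_mono)
  let ?good = "\<lambda>t. norm (w t) < a \<and> (\<forall>n. norm (w t) \<le> r n \<longrightarrow> \<phi> (w t) + H t = m n)"
  have ae: "AE t in M. ?good t"
    using int m by (simp add: AE_all_countable)
  \<comment> \<open>A property holding almost everywhere has a witness because the interval has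
    positive measure.\<close>
  have "\<exists>t. ?good t"
  proof (rule ccontr)
    assume "\<nexists>t. ?good t"
    then have "?good t = False" for t by blast
    with ae have "AE t in M. False" by (simp only:)
    then have "emeasure M (space M) = 0" by (subst (asm) AE_iff_measurable[OF sets.top]) auto
    then show False using T by (simp add: emeasure_restrict_space)
  qed
  then obtain t0 where t0: "?good t0" by blast
  have lev: "\<exists>n. norm x \<le> r n" if "norm x < a" for x :: 'a
  proof -
    have "\<forall>\<^sub>F n in sequentially. norm x < r n" using rlim that by (intro order_tendstoD(1)) auto
    then show ?thesis by (auto simp: eventually_sequentially intro: less_imp_le)
  qed
  have "AE t in M. w t = \<psi> (\<phi> (w t0) + H t0 - H t)"
    using ae
  proof eventually_elim
    case (elim t)
    obtain n n' where n: "norm (w t) \<le> r n" "norm (w t0) \<le> r n'" using elim t0 lev by metis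
    let ?k = "max n n'"
    have "norm (w t) \<le> r ?k" "norm (w t0) \<le> r ?k"
      using n mono[of n ?k] mono[of n' ?k] by auto
    then have "\<phi> (w t) + H t = \<phi> (w t0) + H t0" using elim t0 by metis
    then have "\<phi> (w t0) + H t0 - H t = \<phi> (w t)" by (simp add: algebra_simps)
    then show ?case using psi_phi elim by simp
  qed
  then show thesis by (rule that)
qed

end

section \<open>From critical points to solutions\<close>

lemma convex_on_if_strictly_convex_on:
  assumes "strictly_convex_on S f"
  shows "convex_on S f"
proof (rule convex_onI)
  show "convex S" using assms by (simp add: strictly_convex_on_def)
  fix s :: real and x y assume s: "0 < s" "s < 1" and xy: "x \<in> S" "y \<in> S"
  show "f ((1 - s) *\<^sub>R x + s *\<^sub>R y) \<le> (1 - s) * f x + s * f y"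
  proof (cases "x = y")
    case True
    have "(1 - s) *\<^sub>R x + s *\<^sub>R x = x" by (simp add: algebra_simps)
    then show ?thesis using True by (simp add: algebra_simps)
  next
    case False
    then show ?thesis using assms s xy unfolding strictly_convex_on_def by (intro less_imp_le) blast
  qed
qed

text \<open>The chosen weak derivative can be exchanged for a representative with values in the
  closed ball, where continuity of \<open>\<Phi>\<close> gives measurability.\<close>

lemma Psi_eq:
  fixes q v :: "real \<Rightarrow> 'a::euclidean_space"
  assumes v: "v \<in> K_set T a" and ae: "AE t in lebesgue_on {0..T}. weak_deriv T v t = q t"
    and q: "q \<in> borel_measurable (lebesgue_on {0..T})" "\<And>t. norm (q t) \<le> a"
    and Phi: "continuous_on (cball 0 a) \<Phi>"
  shows "Psi T a \<Phi> v = ereal (LINT t|lebesgue_on {0..T}. \<Phi> (q t) - \<Phi> 0)"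
proof -
  have m: "(\<lambda>t. \<Phi> (q t) - \<Phi> 0) \<in> borel_measurable (lebesgue_on {0..T})"
    by (intro borel_measurable_diff borel_measurable_const borel_measurable_continuous_on_comp[OF Phi q(1)])
       (use q in simp)
  have e: "AE t in lebesgue_on {0..T}. \<Phi> (q t) - \<Phi> 0 = \<Phi> (weak_deriv T v t) - \<Phi> 0"
    using ae by eventually_elim simp
  have "(LINT t|lebesgue_on {0..T}. \<Phi> (weak_deriv T v t) - \<Phi> 0) = (LINT t|lebesgue_on {0..T}. \<Phi> (q t) - \<Phi> 0)"
    by (rule integral_cong_AE[OF borel_measurable_lebesgue_on_AE_cong[OF m _ e] m]) (use e in auto)
  then show ?thesis using v by (simp add: Psi_def)
qed

text \<open>Each admissible pair x, q is the initial value and derivative of a competitor in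
  \<open>K_set\<close>. Allowing any upper bound J1 for the boundary term lets convexity estimates
  of j be inserted directly; properness makes the actual value finite.\<close>

lemma critical_point_imp_reduced_problem:
  fixes u w :: "real \<Rightarrow> 'a::euclidean_space"
  assumes pot: "convex_potential a \<phi> \<psi> \<Phi>" and T: "T > 0"
    and F_cont: "continuous_on ({0..T} \<times> UNIV) (\<lambda>(t, x). F t x)"
    and F_grad: "\<And>t x. t \<in> {0..T} \<Longrightarrow> GDERIV (F t) x :> g t x"
    and g_cont: "continuous_on ({0..T} \<times> UNIV) (\<lambda>(t, x). g t x)"
    and j_proper: "proper_fun j"
    and crit: "critical_point T a \<Phi> j F u"
    and w: "w \<in> borel_measurable (lebesgue_on {0..T})" "\<And>t. norm (w t) \<le> a"
    and uw: "\<And>t. t \<in> {0..T} \<Longrightarrow> u t = u 0 + integral {0..t} w"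
    and wd: "AE t in lebesgue_on {0..T}. weak_deriv T u t = w t"
    and J0: "j (u 0, u T) = ereal J0"
  shows "reduced_problem a \<phi> \<psi> \<Phi> T (\<lambda>t. g t (u t)) w j (u 0) (u T) J0"
proof -
  let ?M = "lebesgue_on {0..T}"
  interpret convex_potential a \<phi> \<psi> \<Phi> by (rule pot)
  have uK: "u \<in> K_set T a" using crit by (simp add: critical_point_def PsiJ_dom_def)
  have uC: "u \<in> C0 T" using uK by (simp add: K_set_def W1inf_def)
  then have uc: "continuous_on {0..T} u" by (simp add: C0_def)
  have hc: "continuous_on {0..T} (\<lambda>t. g t (u t))"
  proof -
    have "continuous_on {0..T} (\<lambda>t. case (t, u t) of (t, x) \<Rightarrow> g t x)"
      by (rule continuous_on_compose2[OF g_cont]) (auto intro!: continuous_intros uc)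
    then show ?thesis by simp
  qed
  have wi: "integrable ?M w" by (rule integrable_bounded_ivl[OF w])
  obtain C where C: "\<And>x. x \<in> cball 0 a \<Longrightarrow> norm (\<Phi> x) \<le> C"
    using compact_imp_bounded[OF compact_continuous_image[OF cont compact_cball]]
    unfolding bounded_iff by blast
  have Phi_int: "integrable ?M (\<lambda>t. \<Phi> (q t))"
    if "q \<in> borel_measurable ?M" "\<And>t. norm (q t) \<le> a" for q
    by (rule integrable_bounded_ivl[OF borel_measurable_continuous_on_comp[OF cont that(1)], where B=C])
       (use that(2) C in auto)
  have var: "0 \<le> (LINT t|?M. \<Phi> (q t) - \<Phi> (w t)) + (J1 - J0)
        - (LINT t|?M. g t (u t) \<bullet> (x - u 0 + integral {0..t} (\<lambda>r. q r - w r)))"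
    if q: "q \<in> borel_measurable ?M" "\<And>t. norm (q t) \<le> a"
      and J1: "j (x, x + integral {0..T} q) \<le> ereal J1" for x q J1
  proof -
    have qi: "integrable ?M q" by (rule integrable_bounded_ivl[OF q])
    define v where "v t = x + integral {0..t} q" for t
    have vK: "v \<in> K_set T a" and vd: "AE t in ?M. weak_deriv T v t = q t"
      using K_setI[OF T a q, of v x] by (simp_all add: v_def)
    have vC: "v \<in> C0 T" using vK by (simp add: K_set_def W1inf_def)
    have v0T: "v 0 = x" "v T = x + integral {0..T} q" by (simp_all add: v_def)
    have jv: "j (v 0, v T) \<le> ereal J1" using J1 v0T by simp
    then have "j (v 0, v T) < \<infinity>" by (rule order.strict_trans1) simp
    with vK have vD: "v \<in> PsiJ_dom T a j" by (simp add: PsiJ_dom_def)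
    have "j (v 0, v T) \<noteq> - \<infinity>" using j_proper by (simp add: proper_fun_def)
    then obtain Jv where Jv: "j (v 0, v T) = ereal Jv" "Jv \<le> J1"
      using jv by (cases "j (v 0, v T)") auto
    let ?k = "\<lambda>t. v t - u t"
    have kC: "?k \<in> C0 T" using vC uC by (auto simp: C0_def intro: continuous_intros)
    have fd: "frechet_deriv_C T (F_fun T F) u ?k = - (LINT t|?M. g t (u t) \<bullet> ?k t)"
      by (rule frechet_deriv_C_F_fun[OF T F_cont _ g_cont uC kC]) (rule F_grad)
    have "0 \<le> (Psi T a \<Phi> v + J_fun T j v) - (Psi T a \<Phi> u + J_fun T j u)
        + ereal (frechet_deriv_C T (F_fun T F) u ?k)"
      using crit vD unfolding critical_point_def by blast
    then have "0 \<le> ((LINT t|?M. \<Phi> (q t) - \<Phi> 0) + Jv) - ((LINT t|?M. \<Phi> (w t) - \<Phi> 0) + J0)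
        - (LINT t|?M. g t (u t) \<bullet> ?k t)"
      unfolding Psi_eq[OF vK vd q cont] Psi_eq[OF uK wd w cont] fd J_fun_def Jv(1) J0
      by (simp add: zero_ereal_def del: ereal_0_le_uminus_iff)
    moreover have "(LINT t|?M. \<Phi> (q t) - \<Phi> 0) - (LINT t|?M. \<Phi> (w t) - \<Phi> 0) = (LINT t|?M. \<Phi> (q t) - \<Phi> (w t))"
      using Phi_int[OF q] Phi_int[OF w] by simp
    moreover have "(LINT t|?M. g t (u t) \<bullet> ?k t) =
        (LINT t|?M. g t (u t) \<bullet> (x - u 0 + integral {0..t} (\<lambda>r. q r - w r)))"
    proof (rule Bochner_Integration.integral_cong)
      fix t assume "t \<in> space ?M"
      then have t: "t \<in> {0..T}" by simp
      have sub: "{0..t} \<subseteq> {0..T}" using t by auto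
      have "q integrable_on {0..T}" "w integrable_on {0..T}"
        by (rule integrable_on_lebesgue_on[OF qi], simp, rule integrable_on_lebesgue_on[OF wi], simp)
      then have "integral {0..t} (\<lambda>r. q r - w r) = integral {0..t} q - integral {0..t} w"
        by (intro integral_diff integrable_on_subinterval[OF _ sub])
      then have "?k t = x - u 0 + integral {0..t} (\<lambda>r. q r - w r)"
        using uw[OF t] by (simp add: v_def)
      then show "g t (u t) \<bullet> ?k t = g t (u t) \<bullet> (x - u 0 + integral {0..t} (\<lambda>r. q r - w r))"
        by (rule arg_cong)
    qed simp
    ultimately show ?thesis using Jv(2) by linarith
  qed
  show ?thesis
    by unfold_locales (use T w hc J0 var uw[of T] in auto)
qed

section \<open>Classical derivatives on the closed interval and the final assembly\<close>

lemma has_vector_derivative_primitive: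
  fixes f :: "real \<Rightarrow> 'a::euclidean_space"
  assumes "continuous_on {0..T} f" "\<And>t. t \<in> {0..T} \<Longrightarrow> v t = c + integral {0..t} f" "t \<in> {0..T}"
  shows "(v has_vector_derivative f t) (at t within {0..T})"
proof -
  have "((\<lambda>t. c + integral {0..t} f) has_vector_derivative 0 + f t) (at t within {0..T})"
    by (intro has_vector_derivative_add has_vector_derivative_const integral_has_vector_derivative assms)
  then show ?thesis
    by (intro has_vector_derivative_transform[OF assms(3) assms(2)]) auto
qed

lemma C1_primitive:
  fixes f :: "real \<Rightarrow> 'a::euclidean_space"
  assumes T: "T > 0" and f: "continuous_on {0..T} f"
    and v: "\<And>t. t \<in> {0..T} \<Longrightarrow> v t = c + integral {0..t} f"
  shows "v \<in> C1 T" and "\<And>t. t \<in> {0..T} \<Longrightarrow> ivl_deriv T v t = f t"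
proof -
  note d = has_vector_derivative_primitive[OF f v]
  show eq: "ivl_deriv T v t = f t" if "t \<in> {0..T}" for t
    unfolding ivl_deriv_def using vector_derivative_within_closed_interval[OF T that d[OF _ that]] by simp
  have "continuous_on {0..T} (ivl_deriv T v)"
    using f eq continuous_on_cong[of "{0..T}" "{0..T}" "ivl_deriv T v" f] by auto
  moreover have "v differentiable_on {0..T}"
    using d unfolding differentiable_on_def differentiable_def has_vector_derivative_def by blast
  ultimately show "v \<in> C1 T" by (simp add: C1_def)
qed

theorem theorem3p2:
  fixes T a :: real
    and \<phi> :: "real ^ 'n \<Rightarrow> real ^ 'n"
    and \<Phi> :: "real ^ 'n \<Rightarrow> real"
    and F :: "real \<Rightarrow> real ^ 'n \<Rightarrow> real"
    and j :: "(real ^ 'n) \<times> (real ^ 'n) \<Rightarrow> ereal"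
    and u :: "real \<Rightarrow> real ^ 'n"
  assumes "T > 0" and "a > 0"
    and phi_homeo: "\<exists>\<psi>. homeomorphism (ball 0 a) UNIV \<phi> \<psi>"
    and phi_0: "\<phi> 0 = 0"
    and Phi_grad: "\<And>x. x \<in> ball 0 a \<Longrightarrow> GDERIV \<Phi> x :> \<phi> x"
    and Phi_nonpos: "\<And>x. x \<in> cball 0 a \<Longrightarrow> \<Phi> x \<le> 0"
    and Phi_C1: "continuous_on (ball 0 a) (gradient \<Phi>)"
    and Phi_cont: "continuous_on (cball 0 a) \<Phi>"
    and Phi_convex: "strictly_convex_on (cball 0 a) \<Phi>"
    and F_cont: "continuous_on ({0..T} \<times> UNIV) (\<lambda>(t, x). F t x)"
    and F_grad: "\<And>t x. t \<in> {0..T} \<Longrightarrow> \<exists>D. GDERIV (F t) x :> D"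
    and F_grad_cont: "continuous_on ({0..T} \<times> UNIV) (\<lambda>(t, x). gradient (F t) x)"
    and F_0: "\<And>t. t \<in> {0..T} \<Longrightarrow> F t 0 = 0"
    and j_proper: "proper_fun j"
    and j_convex: "ereal_convex j"
    and j_lsc: "lower_semicontinuous j"
    and j_0: "j 0 = 0"
    and j_subdiff_0: "0 \<in> subdifferential j 0"
    and crit: "critical_point T a \<Phi> j F u"
  shows "bvp_solution T a \<phi> j F u"
proof -
  let ?M = "lebesgue_on {0..T}"
  note T = \<open>T > 0\<close> and a = \<open>a > 0\<close>
  obtain \<psi> where psi: "homeomorphism (ball 0 a) UNIV \<phi> \<psi>" using phi_homeo by blast
  interpret convex_potential a \<phi> \<psi> \<Phi>
    by unfold_locales (use a psi phi_0 Phi_grad Phi_cont convex_on_if_strictly_convex_on[OF Phi_convex] in auto)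
  have pot: "convex_potential a \<phi> \<psi> \<Phi>" by unfold_locales
  have Fg: "GDERIV (F t) x :> gradient (F t) x" if "t \<in> {0..T}" for t x
    using F_grad[OF that] GDERIV_gradient by blast
  have uD: "u \<in> PsiJ_dom T a j" using crit by (simp add: critical_point_def)
  then have uK: "u \<in> K_set T a" and ju: "j (u 0, u T) < \<infinity>" by (simp_all add: PsiJ_dom_def)
  have j_fin: "j z \<noteq> - \<infinity>" for z using j_proper unfolding proper_fun_def by blast
  obtain J0 where J0: "j (u 0, u T) = ereal J0"
    using ju j_fin[of "(u 0, u T)"] by (cases "j (u 0, u T)") auto
  \<comment> \<open>This is the subgradient inequality at the origin with subgradient 0.\<close>
  have j_nonneg: "0 \<le> j z" for z using j_subdiff_0 j_0 by (cases z) (simp add: subdifferential_def zero_ereal_def)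
  obtain w where w: "w \<in> borel_measurable ?M" "\<And>t. norm (w t) \<le> a"
      "\<And>t. t \<in> {0..T} \<Longrightarrow> u t = u 0 + integral {0..t} w"
      "AE t in ?M. weak_deriv T u t = w t"
    using K_setD[OF uK T a] by blast
  define h where "h t = gradient (F t) (u t)" for t
  have red: "reduced_problem a \<phi> \<psi> \<Phi> T h q j (u 0) (u T) J0"
    if "q \<in> borel_measurable ?M" "\<And>t. norm (q t) \<le> a"
      "\<And>t. t \<in> {0..T} \<Longrightarrow> u t = u 0 + integral {0..t} q"
      "AE t in ?M. weak_deriv T u t = q t" for q
    unfolding h_def
    by (rule critical_point_imp_reduced_problem[OF pot T F_cont _ F_grad_cont j_proper crit that J0])
       (rule Fg)
  interpret R: reduced_problem a \<phi> \<psi> \<Phi> T h w j "u 0" "u T" J0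
    by (rule red[OF w])
  obtain c where c: "AE t in ?M. w t = \<psi> (c - R.H t)"
    using R.Euler_Lagrange[OF R.derivative_interior] j_0 j_nonneg j_convex by (auto simp: zero_prod_def)
  define p where "p t = \<psi> (c - R.H t)" for t
  have pc: "continuous_on {0..T} p"
    unfolding p_def by (rule continuous_on_compose2[OF psi_cont]) (auto intro!: continuous_intros R.H_cont)
  have pl: "norm (p t) < a" for t by (simp add: p_def psi_less)
  have pm: "p \<in> borel_measurable ?M" by (rule continuous_imp_measurable_on_sets_lebesgue[OF pc]) simp
  \<comment> \<open>Changing w on a null set does not affect the primitive, so the continuous p can
    take its place.\<close>
  have up: "u t = u 0 + integral {0..t} p" if t: "t \<in> {0..T}" for t
  proof -
    have "negligible {t \<in> {0..T}. w t \<noteq> p t}"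
    proof -
      have "AE t in lebesgue. t \<in> {0..T} \<longrightarrow> w t = p t"
        using c by (subst (asm) AE_restrict_space_iff) (auto simp: p_def)
      then have "{t \<in> {0..T}. w t \<noteq> p t} \<in> null_sets lebesgue"
        by (subst (asm) completion.AE_iff_null_sets) (auto simp: conj_commute)
      then show ?thesis by (simp add: negligible_iff_null_sets)
    qed
    then have "integral {0..t} w = integral {0..t} p"
      by (rule integral_spike) (use t in auto)
    then show ?thesis using w(3)[OF t] by simp
  qed
  have pd: "AE t in ?M. weak_deriv T u t = p t"
    using w(4) c by eventually_elim (simp add: p_def)
  \<comment> \<open>The same inequality for the continuous representative; its H is that of the
    first instance, as only h enters.\<close>
  interpret P: reduced_problem a \<phi> \<psi> \<Phi> T h p j "u 0" "u T" J0
    by (rule red[OF pm less_imp_le[OF pl] up pd])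
  have H: "P.H t = integral {0..t} h" "R.H t = integral {0..t} h" for t
    by (simp_all add: P.H_def R.H_def)
  have uC1: "u \<in> C1 T" and ud: "ivl_deriv T u t = p t" if "t \<in> {0..T}" for t
    using C1_primitive[OF T pc up] that by auto
  have phi_p: "\<phi> (p t) = c - R.H t" for t by (simp add: p_def phi_psi)
  have flux: "\<phi> (ivl_deriv T u t) = c + integral {0..t} (\<lambda>r. - h r)" if "t \<in> {0..T}" for t
    using ud[OF that] by (simp add: phi_p H)
  have hc: "continuous_on {0..T} (\<lambda>r. - h r)" by (intro continuous_intros R.h_cont)
  note flux_C1 = C1_primitive[OF T hc flux]
  \<comment> \<open>Compactness turns the pointwise strict bound into one radius r below
    \<open>a\<close>, valid on all of \<open>{0..T}\<close>.\<close>
  have "\<exists>x\<in>{0..T}. \<forall>y\<in>{0..T}. norm (p y) \<le> norm (p x)"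
    using T by (intro continuous_attains_sup continuous_intros pc) auto
  then obtain r where r: "r < a" "0 \<le> r" "\<And>t. t \<in> {0..T} \<Longrightarrow> norm (p t) \<le> r"
    using pl by (metis norm_ge_zero)
  have bc: "(\<phi> (p 0), - \<phi> (p T)) \<in> subdifferential j (u 0, u T)"
    unfolding subdifferential_def
  proof (intro CollectI allI)
    fix \<xi> :: "(real ^ 'n) \<times> (real ^ 'n)"
    obtain x y where \<xi>: "\<xi> = (x, y)" by (cases \<xi>)
    show "j (u 0, u T) + ereal ((\<phi> (p 0), - \<phi> (p T)) \<bullet> (\<xi> - (u 0, u T))) \<le> j \<xi>"
    proof (cases "j \<xi>")
      case (real J1)
      \<comment> \<open>The slope of the affine function from x to y minus the derivative of u.
        Outside \<open>{0..T}\<close> it is cut to 0, because the alternative required by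
        \<open>first_variation\<close> ranges over all reals while r bounds p only on the
        interval.\<close>
      define z where "z t = (if t \<in> {0..T} then (y - x) /\<^sub>R T - p t else 0)" for t
      have zm: "z \<in> borel_measurable ?M" 
        by (subst measurable_cong[where g="\<lambda>t. (y - x) /\<^sub>R T - p t"]) (use pm in \<open>auto simp: z_def\<close>)
      have zb: "norm (z t) \<le> norm ((y - x) /\<^sub>R T) + a" for t
        using norm_triangle_ineq4[of "(y - x) /\<^sub>R T" "p t"] pl[of t] a by (auto simp: z_def)
      have pi: "p integrable_on {0..T}" by (rule integrable_continuous_real[OF pc])
      have "integral {0..T} z = integral {0..T} (\<lambda>t. (y - x) /\<^sub>R T - p t)"
        by (rule integral_cong) (simp add: z_def)
      also have "\<dots> = integral {0..T} (\<lambda>t. (y - x) /\<^sub>R T) - integral {0..T} p"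
        by (rule integral_diff[OF integrable_const_ivl pi])
      also have "\<dots> = (y - x) - (u T - u 0)" using T up[of T] by simp
      finally have zI: "integral {0..T} z = (y - x) - (u T - u 0)" .
      have "0 \<le> (LINT t|?M. \<phi> (p t) \<bullet> z t) + (J1 - J0) - P.load (x - u 0) z"
      proof (rule P.first_variation[OF zm zb r(1,2)])
        show "norm (p t) \<le> r \<or> z t = 0" for t using r(3) by (auto simp: z_def)
        fix s :: real assume s: "0 < s" "s < 1"
        have "j ((1 - s) *\<^sub>R (u 0, u T) + s *\<^sub>R (x, y)) \<le> ereal (1 - s) * j (u 0, u T) + ereal s * j (x, y)"
          using j_convex s unfolding ereal_convex_def by blast
        also have "\<dots> = ereal (J0 + s * (J1 - J0))" using real \<xi> J0 by (simp add: algebra_simps)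
        also have "(1 - s) *\<^sub>R (u 0, u T) + s *\<^sub>R (x, y) =
            (u 0 + s *\<^sub>R (x - u 0), u T + s *\<^sub>R (x - u 0 + integral {0..T} z))"
          by (simp add: zI algebra_simps)
        finally show "j (u 0 + s *\<^sub>R (x - u 0), u T + s *\<^sub>R (x - u 0 + integral {0..T} z)) \<le> ereal (J0 + s * (J1 - J0))" .
      qed
      also have "(LINT t|?M. \<phi> (p t) \<bullet> z t) = (LINT t|?M. c \<bullet> z t - P.H t \<bullet> z t)"
        by (simp add: phi_p H inner_diff_left)
      also have "\<dots> = c \<bullet> integral {0..T} z - (LINT t|?M. P.H t \<bullet> z t)"
      proof -
        have zi: "integrable ?M z" by (rule integrable_bounded_ivl[OF zm zb])
        obtain D where D: "\<And>t. t \<in> {0..T} \<Longrightarrow> norm (P.H t) \<le> D" using P.H_bounded by blast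
        have "integrable ?M (\<lambda>t. P.H t \<bullet> z t)"
        proof (rule integrable_bounded_ivl)
          show "norm (P.H t \<bullet> z t) \<le> D * (norm ((y - x) /\<^sub>R T) + a)" if "t \<in> {0..T}" for t
            using D[OF that] zb[of t] order_trans[OF norm_ge_zero D[OF that]] unfolding real_norm_def
            by (intro order_trans[OF Cauchy_Schwarz_ineq2] mult_mono) auto
        qed (use P.H_meas zm in auto)
        then show ?thesis using zi lebesgue_integral_eq_integral[OF zi] by simp
      qed
      \<comment> \<open>The integrals of \<open>P.H t \<bullet> z t\<close> cancel against those in
        \<open>P.load\<close>. Since \<open>H\<close> vanishes at 0, c is the flux at 0, and
        \<open>c - P.H T\<close> is the flux at T.\<close>
      finally have "J0 + (c \<bullet> (x - u 0) - (c - P.H T) \<bullet> (y - u T)) \<le> J1"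
        by (simp add: P.load_def zI inner_diff_left inner_diff_right)
      then show ?thesis
        using real J0 \<xi> by (simp add: phi_p H inner_diff_left inner_diff_right)
    qed (use j_fin in auto)
  qed
  have "0 \<in> {0..T}" "T \<in> {0..T}" using T by auto
  with bc have bc': "(\<phi> (ivl_deriv T u 0), - \<phi> (ivl_deriv T u T)) \<in> subdifferential j (u 0, u T)"
    by (simp add: ud)
  show ?thesis
    unfolding bvp_solution_def
  proof (intro conjI ballI)
    show "u \<in> C1 T" using uC1[of 0] T by simp
    show "norm (ivl_deriv T u t) < a" if "t \<in> {0..T}" for t using ud[OF that] pl by simp
    show "(\<lambda>t. \<phi> (ivl_deriv T u t)) \<in> C1 T" by (rule flux_C1(1))
    show "- ivl_deriv T (\<lambda>s. \<phi> (ivl_deriv T u s)) t = gradient (F t) (u t)" if "t \<in> {0..T}" for t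
      using flux_C1(2)[OF _ that] by (simp add: h_def)
    show "(u 0, u T) \<in> subdiff_dom j" using bc' by (auto simp: subdiff_dom_def)
  qed (rule bc')
qed

end
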